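(* There is an algorithm that, given as input a graph $G$, determines whether $G$ contains a bull or an odd hole, and runs in time $O(|V(G)|^5)$.
   Context: All graphs are finite and simple. $G$ contains $H$ if $G$ has an induced subgraph isomorphic to $H$. The bull is the graph consisting of a triangle with two disjoint pendant edges (vertices $x,y,z,p,q$ with $xyz$ a triangle, $p$ adjacent only to $x$, $q$ adjacent only to $y$). A hole is an induced subgraph isomorphic to a cycle $C_k$ with $k\ge 4$; it is odd if $k$ is odd. *)

theory Defs
  imports Main
begin

definition simple_graph :: "nat \<Rightarrow> (nat \<Rightarrow> nat \<Rightarrow> bool) \<Rightarrow> bool" where
  "simple_graph n E \<longleftrightarrow> (\<forall>u<n. \<forall>v<n. E u v \<longleftrightarrow> E v u) \<and> (\<forall>u<n. \<not> E u u)"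

definition contains ::
  "nat \<Rightarrow> (nat \<Rightarrow> nat \<Rightarrow> bool) \<Rightarrow> nat \<Rightarrow> (nat \<Rightarrow> nat \<Rightarrow> bool) \<Rightarrow> bool" where
  "contains n E m F \<longleftrightarrow>
     (\<exists>f. inj_on f {..<m} \<and> f ` {..<m} \<subseteq> {..<n} \<and>
          (\<forall>u<m. \<forall>v<m. F u v \<longleftrightarrow> E (f u) (f v)))"

text \<open>The bull on vertices 0=x, 1=y, 2=z, 3=p, 4=q: triangle xyz, p adjacent only to x,
  q adjacent only to y.\<close>
definition bull_adj :: "nat \<Rightarrow> nat \<Rightarrow> bool" where
  "bull_adj u v \<longleftrightarrow> {u, v} \<in> {{0,1}, {0,2}, {1,2}, {0,3}, {1,4}}"

definition cycle_adj :: "nat \<Rightarrow> nat \<Rightarrow> nat \<Rightarrow> bool" where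
  "cycle_adj k u v \<longleftrightarrow> u < k \<and> v < k \<and> (v = (u + 1) mod k \<or> u = (v + 1) mod k)"

definition contains_bull :: "nat \<Rightarrow> (nat \<Rightarrow> nat \<Rightarrow> bool) \<Rightarrow> bool" where
  "contains_bull n E \<longleftrightarrow> contains n E 5 bull_adj"

definition contains_odd_hole :: "nat \<Rightarrow> (nat \<Rightarrow> nat \<Rightarrow> bool) \<Rightarrow> bool" where
  "contains_odd_hole n E \<longleftrightarrow> (\<exists>k\<ge>4. odd k \<and> contains n E k (cycle_adj k))"

text \<open>Registers and memory cells hold natural numbers; every instruction costs one
  step. To make this a word-RAM (word size O(log n)), the statement below requires
  that all stored values stay polynomially bounded in the input size.\<close>

datatype instr =
    Const nat nat
  | Add nat nat nat
  | Sub nat nat nat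
  | Mul nat nat nat
  | Div nat nat nat
  | Load nat nat
  | Store nat nat
  | Jz nat nat
  | Jmp nat
  | Halt

datatype state = St (pc: nat) (regs: "nat \<Rightarrow> nat") (mem: "nat \<Rightarrow> nat")

definition halted :: "instr list \<Rightarrow> state \<Rightarrow> bool" where
  "halted P s \<longleftrightarrow> pc s \<ge> length P \<or> P ! pc s = Halt"

fun exec_instr :: "instr \<Rightarrow> state \<Rightarrow> state" where
  "exec_instr (Const r c) (St p R M) = St (Suc p) (R(r := c)) M"
| "exec_instr (Add r a b) (St p R M) = St (Suc p) (R(r := R a + R b)) M"
| "exec_instr (Sub r a b) (St p R M) = St (Suc p) (R(r := R a - R b)) M"
| "exec_instr (Mul r a b) (St p R M) = St (Suc p) (R(r := R a * R b)) M"
| "exec_instr (Div r a b) (St p R M) = St (Suc p) (R(r := R a div R b)) M"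
| "exec_instr (Load r a) (St p R M) = St (Suc p) (R(r := M (R a))) M"
| "exec_instr (Store a b) (St p R M) = St (Suc p) R (M(R a := R b))"
| "exec_instr (Jz r l) (St p R M) = St (if R r = 0 then l else Suc p) R M"
| "exec_instr (Jmp l) (St p R M) = St l R M"
| "exec_instr Halt s = s"

definition step :: "instr list \<Rightarrow> state \<Rightarrow> state" where
  "step P s = (if halted P s then s else exec_instr (P ! pc s) s)"

definition run :: "instr list \<Rightarrow> nat \<Rightarrow> state \<Rightarrow> state" where
  "run P t s = (step P ^^ t) s"

text \<open>Input encoding: register 0 holds n, all other registers are 0; memory cell
  i*n+j holds 1 if ij is an edge and 0 otherwise (adjacency matrix), all other cells 0.\<close>
definition init_state :: "nat \<Rightarrow> (nat \<Rightarrow> nat \<Rightarrow> bool) \<Rightarrow> state" where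
  "init_state n E = St 0 ((\<lambda>_. 0)(0 := n))
     (\<lambda>a. if a < n * n \<and> E (a div n) (a mod n) then 1 else 0)"

definition values_bounded :: "nat \<Rightarrow> state \<Rightarrow> bool" where
  "values_bounded B s \<longleftrightarrow> (\<forall>r. regs s r \<le> B) \<and> (\<forall>a. mem s a \<le> B)"

definition decides_in_time ::
  "instr list \<Rightarrow> (nat \<Rightarrow> (nat \<Rightarrow> nat \<Rightarrow> bool) \<Rightarrow> bool) \<Rightarrow> (nat \<Rightarrow> nat) \<Rightarrow> nat \<Rightarrow> bool" where
  "decides_in_time P Q T k \<longleftrightarrow>
     (\<forall>n E. simple_graph n E \<longrightarrow>
        (\<exists>t\<le>T n. halted P (run P t (init_state n E)) \<and>
           regs (run P t (init_state n E)) 0 = (if Q n E then 1 else 0) \<and>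
           (\<forall>t'\<le>t. values_bounded ((n + 2) ^ k) (run P t' (init_state n E)))))"

end

(* The algorithm first searches for a bull among all 5-tuples. For every edge cd it then deletes the
   common neighbours of c and d, computes distances from c and from d, and looks for an apex: a
   vertex w at the same distance k from c and d, with non-adjacent neighbours a and b at distance
   k - 1 from c and d respectively, such that a is farther from d and b is farther from c.

   Soundness: geodesics from c to a and from d to b, closed up by w and by the edge cd, form an odd
   closed walk, and comparing distances shows that its vertices span no triangle. A shortest odd
   closed walk in a triangle-free graph is an odd hole.

   Completeness: let C be a shortest odd hole in a bull-free graph, of length at least 7. A vertex with
   two neighbours on C is complete to C or looks like a vertex x of C, being adjacent to both
   neighbours of x on C and to no other vertex of C except possibly x. Deleting the common
   neighbours of two consecutive vertices c, d of C removes all complete vertices, and then C is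
   isometric. So the vertex of C opposite to the edge cd is an apex. *)
theory Submission
  imports Defs
begin

section \<open>Holes and odd closed walks\<close>

text \<open>The exponent 5 is reached by both searches. The bull search is five nested loops. The
  other one spends about n^3 steps on each of at most n^2 pairs cd: on the triples (w, a, b), and on
  a breadth-first search that rescans all pairs of vertices for every layer and so needs no queue.
  An apex yields an odd hole whether or not there is a bull, so both searches simply raise the same
  flag.

  The obstacle to completeness is that distances in the graph may be smaller than distances along C:
  one vertex complete to C brings any two vertices of C within distance 2. Such a vertex sees both
  ends of every edge of C, whereas no vertex of C sees both ends of one, C having no triangle. Hence
  deleting for a single edge keeps C intact. The remaining danger, a shortcut through a clone, is
  met by moving the clone into the hole, which is why isometry has to be proved for many holes at
  once.

  Length 5 stands apart: the arguments with bulls need more room on the cycle. There, however, only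
  walks of length at most 1 have to be controlled.\<close>

definition hole :: "('a \<times> 'a) set \<Rightarrow> int \<Rightarrow> (int \<Rightarrow> 'a) \<Rightarrow> bool" where
  "hole R L g \<longleftrightarrow> (\<forall>i j. g i = g j \<longleftrightarrow> L dvd i - j) \<and>
     (\<forall>i j. (g i, g j) \<in> R \<longleftrightarrow> L dvd i - j - 1 \<or> L dvd i - j + 1)"

text \<open>The form in which \<open>contains\<close> presents a hole. In contrast,
  \<open>hole\<close> winds the cycle around the integers with period \<open>L\<close>, so that
  rotations and arcs in either direction become integer arithmetic.\<close>

definition nat_hole :: "('a \<times> 'a) set \<Rightarrow> nat \<Rightarrow> (nat \<Rightarrow> 'a) \<Rightarrow> bool" where
  "nat_hole R k f \<longleftrightarrow> inj_on f {..<k} \<and> (\<forall>u<k. \<forall>v<k. cycle_adj k u v \<longleftrightarrow> (f u, f v) \<in> R)"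

definition has_triangle :: "('a \<times> 'a) set \<Rightarrow> bool" where
  "has_triangle R \<longleftrightarrow> (\<exists>x y z. (x, y) \<in> R \<and> (y, z) \<in> R \<and> (x, z) \<in> R)"

lemma cycle_adj_iff_dvd:
  assumes "u < k" "v < k"
  shows "cycle_adj k u v \<longleftrightarrow> int k dvd int u - int v - 1 \<or> int k dvd int u - int v + 1"
proof -
  have succ: "b = (a + 1) mod k \<longleftrightarrow> int k dvd int a - int b + 1" if "b < k" for a b
  proof -
    have "b = (a + 1) mod k \<longleftrightarrow> int (a + 1) mod int k = int b mod int k"
      using that by (metis mod_less of_nat_eq_iff zmod_int)
    also have "\<dots> \<longleftrightarrow> int k dvd int a - int b + 1"
      by (simp add: mod_eq_dvd_iff algebra_simps)
    finally show ?thesis .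
  qed
  have "int k dvd int v - int u + 1 \<longleftrightarrow> int k dvd int u - int v - 1"
    using dvd_minus_iff[of "int k" "int v - int u + 1"] by (simp add: algebra_simps)
  then show ?thesis
    using succ[OF assms(2), of u] succ[OF assms(1), of v] assms
    unfolding cycle_adj_def by blast
qed

lemma hole_of_nat_hole:
  assumes "nat_hole R k f" "k > 0"
  shows "hole R (int k) (\<lambda>i. f (nat (i mod int k)))"
proof -
  have lt: "nat (i mod int k) < k" for i
    using assms(2) by (simp add: nat_less_iff)
  have int_nat: "int (nat (i mod int k)) = i mod int k" for i
    using assms(2) by simp
  have dvd: "int k dvd i mod int k - j mod int k + c \<longleftrightarrow> int k dvd i - j + c" for i j c
  proof -
    have "(i mod int k - j mod int k + c) mod int k = (i - j + c) mod int k"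
      by (metis mod_add_left_eq mod_diff_eq)
    then show ?thesis
      by (simp add: dvd_eq_mod_eq_0)
  qed
  have "f (nat (i mod int k)) = f (nat (j mod int k)) \<longleftrightarrow> int k dvd i - j" for i j
  proof -
    have "f (nat (i mod int k)) = f (nat (j mod int k)) \<longleftrightarrow> nat (i mod int k) = nat (j mod int k)"
      using assms(1) lt unfolding nat_hole_def by (auto dest: inj_onD)
    also have "\<dots> \<longleftrightarrow> i mod int k = j mod int k"
      by (metis int_nat)
    finally show ?thesis
      by (simp add: mod_eq_dvd_iff)
  qed
  moreover have "(f (nat (i mod int k)), f (nat (j mod int k))) \<in> R \<longleftrightarrow>
      int k dvd i - j - 1 \<or> int k dvd i - j + 1" for i j
    using assms(1) lt cycle_adj_iff_dvd[OF lt[of i] lt[of j]] dvd[of i j 1] dvd[of i j "-1"]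
    unfolding nat_hole_def int_nat by simp
  ultimately show ?thesis
    unfolding hole_def by blast
qed

lemma nat_hole_of_hole:
  assumes "hole R (int k) g"
  shows "nat_hole R k (\<lambda>u. g (int u))"
proof -
  have "inj_on (\<lambda>u. g (int u)) {..<k}"
  proof (rule inj_onI)
    fix u v assume uv: "u \<in> {..<k}" "v \<in> {..<k}" "g (int u) = g (int v)"
    then have "int k dvd int u - int v"
      using assms unfolding hole_def by blast
    then have "int u mod int k = int v mod int k"
      by (simp add: mod_eq_dvd_iff)
    with uv show "u = v" by simp
  qed
  then show ?thesis
    using assms cycle_adj_iff_dvd unfolding hole_def nat_hole_def by blast
qed

lemma hole_Restr:
  assumes "hole (Restr R S) L g"
  shows "hole R L g"
proof -
  have "g i \<in> S" for i
  proof -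
    have "(g i, g (i + 1)) \<in> Restr R S"
      using assms unfolding hole_def by simp
    then show ?thesis by simp
  qed
  then show ?thesis
    using assms unfolding hole_def by simp
qed

lemma relpow_segment:
  assumes "\<forall>i<m. (f i, f (Suc i)) \<in> R" "a \<le> b" "b \<le> m"
  shows "(f a, f b) \<in> R ^^ (b - a)"
proof -
  have "\<exists>h. h 0 = f a \<and> h (b - a) = f b \<and> (\<forall>i<b - a. (h i, h (Suc i)) \<in> R)"
    using assms by (intro exI[of _ "\<lambda>i. f (a + i)"]) auto
  then show ?thesis
    unfolding relpow_fun_conv .
qed

lemma relpow_addI: "(x, y) \<in> R ^^ m \<Longrightarrow> (y, z) \<in> R ^^ n \<Longrightarrow> (x, z) \<in> R ^^ (m + n)"
  by (auto simp: relpow_add)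

lemma relpow_sym:
  assumes "sym R"
  shows "(x, y) \<in> R ^^ n \<Longrightarrow> (y, x) \<in> R ^^ n"
proof (induction n arbitrary: y)
  case (Suc n)
  then obtain z where "(x, z) \<in> R ^^ n" "(z, y) \<in> R" by auto
  with Suc.IH assms show ?case
    by (meson relpow_Suc_I2 symD)
qed simp

text \<open>A shortest odd closed walk is a triangle or an odd hole, because a chord or a repeated
  vertex would split it into two closed walks, one of which is odd and shorter.\<close>
lemma odd_closed_walk:
  assumes sym: "sym R" and irr: "irrefl R" and "(x, x) \<in> R ^^ n" "odd n"
    and no: "\<not> has_triangle R"
  obtains m g where "odd m" "5 \<le> m" "m \<le> n" "hole R (int m) g"
proof -
  define P where "P k \<longleftrightarrow> odd k \<and> (\<exists>x. (x, x) \<in> R ^^ k)" for k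
  define m where "m = (LEAST k. P k)"
  have "P n" using assms unfolding P_def by blast
  then have "P m" "m \<le> n"
    unfolding m_def by (auto intro: LeastI Least_le)
  then obtain x where "odd m" "(x, x) \<in> R ^^ m" unfolding P_def by blast
  then obtain f where f: "f 0 = x" "f m = x" "\<forall>i<m. (f i, f (Suc i)) \<in> R"
    unfolding relpow_fun_conv by blast
  have small: "\<not> (odd k \<and> k < m \<and> (y, y) \<in> R ^^ k)" for k y
    using not_less_Least[of k P] unfolding m_def P_def by blast
  have seg: "(f a, f b) \<in> R ^^ (b - a)" if "a \<le> b" "b \<le> m" for a b
    using relpow_segment[OF f(3)] that by blast
  have "m \<noteq> 1"
    using \<open>(x, x) \<in> R ^^ m\<close> irr unfolding irrefl_def by auto
  moreover have "m \<noteq> 3"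
  proof
    assume "m = 3"
    then have "(f 0, f 1) \<in> R" "(f 1, f 2) \<in> R" "(f 2, f 0) \<in> R"
      using f by (auto simp: numeral_eq_Suc)
    then show False
      using no sym unfolding has_triangle_def by (meson symD)
  qed
  ultimately have m5: "5 \<le> m"
    using \<open>odd m\<close> by presburger
  have outer: "(f j, f i) \<in> R ^^ (m - j + i)" if "i < j" "j < m" for i j
    using relpow_addI[of "f j" "f m" "m - j" R "f i" i] seg[of j m] seg[of 0 i] that f by simp
  have neq: "f i \<noteq> f j" if ij: "i < j" "j < m" for i j
  proof
    assume eq: "f i = f j"
    show False
    proof (cases "odd (j - i)")
      case True
      then show False using small[of "j - i" "f i"] seg[of i j] ij eq by auto
    next
      case False
      then have "odd (m - j + i)" "m - j + i < m" using \<open>odd m\<close> ij by presburger+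
      then show False using small[of "m - j + i" "f i"] outer[OF ij] eq by auto
    qed
  qed
  \<comment> \<open>The pair \<open>0\<close>, \<open>m - 1\<close> is left out because it is the
    edge that closes the walk. A chord is added to whichever of the two arcs has even
    length.\<close>
  have chord: "(f i, f j) \<notin> R" if ij: "i + 1 < j" "j < m" "\<not> (i = 0 \<and> j = m - 1)" for i j
  proof
    assume e: "(f i, f j) \<in> R"
    then have e': "(f j, f i) \<in> R" using sym by (meson symD)
    show False
    proof (cases "odd (j - i)")
      case True
      then have "odd (m - j + i + 1)" "m - j + i + 1 < m" using \<open>odd m\<close> ij by presburger+
      then show False
        using small[of _ "f j"] relpow_addI[OF outer[of i j], of "f j" 1] e ij by fastforce
    next
      case False
      then have "odd (j - i + 1)" "j - i + 1 < m" using \<open>odd m\<close> ij by presburger+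
      then show False
        using small[of _ "f i"] relpow_addI[OF seg[of i j], of "f i" 1] e' ij by fastforce
    qed
  qed
  have last: "(f (m - 1), f 0) \<in> R"
    using f m5 by (metis Suc_diff_1 diff_less less_le_trans less_numeral_extra(1) zero_less_numeral)
  have "(f i, f j) \<in> R \<longleftrightarrow> j = i + 1 \<or> (i = 0 \<and> j = m - 1)" if "i < j" "j < m" for i j
  proof (cases "j = i + 1")
    case False
    then show ?thesis
      using chord[of i j] last sym that by (cases "i = 0 \<and> j = m - 1") (auto dest: symD)
  qed (use f(3) that in simp)
  moreover have "cycle_adj m i j \<longleftrightarrow> j = i + 1 \<or> (i = 0 \<and> j = m - 1)" if "i < j" "j < m" for i j
    using that m5 unfolding cycle_adj_def by (cases "j + 1 = m") auto
  ultimately have lt: "cycle_adj m i j \<longleftrightarrow> (f i, f j) \<in> R" if "i < j" "j < m" for i j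
    using that by blast
  have "cycle_adj m i j \<longleftrightarrow> (f i, f j) \<in> R" if "i < m" "j < m" for i j
  proof (cases i j rule: linorder_cases)
    case equal
    have "j \<noteq> (j + 1) mod m" using m5 that(2) by (cases "j + 1 = m") auto
    then show ?thesis using equal irr unfolding cycle_adj_def irrefl_def by auto
  next
    case greater
    then show ?thesis using lt[of j i] that sym unfolding cycle_adj_def by (meson symD)
  qed (use lt that in blast)
  moreover have "inj_on f {..<m}"
    by (rule inj_onI) (metis neq lessThan_iff linorder_neqE_nat)
  ultimately have "nat_hole R m f"
    unfolding nat_hole_def by blast
  then show thesis
    using that \<open>odd m\<close> m5 \<open>m \<le> n\<close> hole_of_nat_hole[of R m f] by force
qed

section \<open>Shortest odd holes in bull-free graphs\<close>

text \<open>Distinctness of the vertices is implied when \<open>R\<close> is symmetric and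
  irreflexive: all ten pairs are prescribed, and no two vertices of the bull have the same
  neighbourhood.\<close>

definition has_bull :: "('a \<times> 'a) set \<Rightarrow> bool" where
  "has_bull R \<longleftrightarrow> (\<exists>x y z p q. (x, y) \<in> R \<and> (x, z) \<in> R \<and> (y, z) \<in> R \<and> (x, p) \<in> R \<and> (y, q) \<in> R \<and>
     (x, q) \<notin> R \<and> (y, p) \<notin> R \<and> (z, p) \<notin> R \<and> (z, q) \<notin> R \<and> (p, q) \<notin> R)"

lemma dvd_small_iff:
  fixes L d :: int
  assumes "\<bar>d\<bar> < L"
  shows "L dvd d \<longleftrightarrow> d = 0"
  using assms zdvd_not_zless[of "\<bar>d\<bar>" L] by (cases "d = 0") auto

lemma hole_eq_iff: "hole R L g \<Longrightarrow> g i = g j \<longleftrightarrow> L dvd i - j"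
  unfolding hole_def by blast

lemma hole_adj_iff: "hole R L g \<Longrightarrow> (g i, g j) \<in> R \<longleftrightarrow> L dvd i - j - 1 \<or> L dvd i - j + 1"
  unfolding hole_def by blast

lemma hole_adj_near_iff: "hole R L g \<Longrightarrow> \<bar>i - j\<bar> + 1 < L \<Longrightarrow> (g i, g j) \<in> R \<longleftrightarrow> \<bar>i - j\<bar> = 1"
  using hole_adj_iff[of R L g i j] dvd_small_iff[of "i - j - 1" L] dvd_small_iff[of "i - j + 1" L]
  by auto

lemma hole_path: "hole R L g \<Longrightarrow> (g i, g (i + int d)) \<in> R ^^ d"
proof (induction d)
  case (Suc d)
  have "(g (i + int d), g (i + int (Suc d))) \<in> R"
    using hole_adj_iff[OF Suc.prems] by simp
  with Suc show ?case by auto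
qed simp

lemma hole_range:
  assumes "hole R L g" "L > 0"
  shows "range g = g ` {i..<i + L}"
proof -
  have "g j \<in> g ` {i..<i + L}" for j
  proof -
    have "g j = g (i + (j - i) mod L)"
      using assms by (simp add: hole_eq_iff) (metis dvd_minus_mod diff_diff_eq)
    then show ?thesis using assms(2) by (intro image_eqI[of _ _ "i + (j - i) mod L"]) auto
  qed
  then show ?thesis by auto
qed

lemma hole_obtain_offset:
  assumes "hole R L g" "L > 0"
  obtains d where "0 \<le> d" "d < L" "g j = g (i + d)"
proof -
  have "g j \<in> g ` {i..<i + L}"
    using hole_range[OF assms] by blast
  then obtain t where "i \<le> t" "t < i + L" "g j = g t" by auto
  then show thesis by (intro that[of "t - i"]) auto
qed

lemma hole_shift: "hole R L g \<Longrightarrow> g i = g j \<Longrightarrow> g (i + d) = g (j + d)"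
  by (simp add: hole_eq_iff)

text \<open>Going round a triangle changes the index by a sum of three signs. This sum is odd and at
  most 3 in absolute value, hence no multiple of \<open>L > 3\<close>.\<close>

lemma hole_no_triangle:
  assumes "hole R L g" "3 < L" "(g i, g j) \<in> R" "(g j, g k) \<in> R" "(g k, g i) \<in> R"
  shows False
proof -
  obtain s t r where *: "s \<in> {1, -1}" "t \<in> {1, -1}" "r \<in> {1, -1}"
    "L dvd i - j + s" "L dvd j - k + t" "L dvd k - i + r"
    using assms(3-5) unfolding hole_adj_iff[OF assms(1)]
    by (metis insertCI diff_conv_add_uminus)
  then have "L dvd (i - j + s) + (j - k + t) + (k - i + r)"
    by (simp only: dvd_add)
  then have "L dvd s + t + r" by (simp add: algebra_simps)
  then show False
    using * assms(2) dvd_small_iff[of "s + t + r" L] by auto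
qed

lemma hole_RestrI: "hole R L' g \<Longrightarrow> range g \<subseteq> S \<Longrightarrow> hole (Restr R S) L' g"
  unfolding hole_def by (auto simp: image_subset_iff)

text \<open>To be instantiated with the graph after the deletion. \<open>L\<close> bounds the
  lengths of odd holes from below; the hole that attains it enters through
  \<open>clean\<close>.\<close>

locale minimal_odd_hole =
  fixes R :: "('a \<times> 'a) set" and L :: nat
  assumes sym: "sym R" and irrefl: "irrefl R" and no_bull: "\<not> has_bull R"
    and odd: "odd L" and ge_7: "L \<ge> 7"
    and minimal: "\<And>m g. odd m \<Longrightarrow> 5 \<le> m \<Longrightarrow> hole R (int m) g \<Longrightarrow> L \<le> m"
begin

text \<open>The second clause excludes vertices complete to the hole. It is tied to \<open>g\<close>
  because it has to be re-established for every hole obtained by an exchange.\<close>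

definition clean :: "(int \<Rightarrow> 'a) \<Rightarrow> bool" where
  "clean g \<longleftrightarrow> hole R (int L) g \<and> (\<forall>z. \<exists>i. (z, g i) \<notin> R)"

lemma irreflD: "(x, x) \<notin> R"
  using irrefl unfolding irrefl_def by blast

lemma sym_iff: "(x, y) \<in> R \<longleftrightarrow> (y, x) \<in> R"
  using sym by (meson symD)

lemma bull_freeD:
  "(x, y) \<in> R \<Longrightarrow> (x, z) \<in> R \<Longrightarrow> (y, z) \<in> R \<Longrightarrow> (x, p) \<in> R \<Longrightarrow> (y, q) \<in> R \<Longrightarrow>
   (x, q) \<notin> R \<Longrightarrow> (y, p) \<notin> R \<Longrightarrow> (z, p) \<notin> R \<Longrightarrow> (z, q) \<notin> R \<Longrightarrow> (p, q) \<notin> R \<Longrightarrow> False"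
  using no_bull unfolding has_bull_def by blast

text \<open>The form in which minimality is used. Confining the walk to \<open>S\<close> matters
  because the resulting triangle then consists of vertices whose adjacencies are known.\<close>

lemma short_odd_closed_walk:
  assumes "(x, x) \<in> (Restr R S) ^^ n" "odd n" "n < L"
  shows "has_triangle (Restr R S)"
proof (rule ccontr)
  assume no: "\<not> has_triangle (Restr R S)"
  have "sym (Restr R S)" "irrefl (Restr R S)"
    using sym irrefl unfolding sym_def irrefl_def by auto
  from odd_closed_walk[OF this assms(1,2) no] obtain m g where
    "odd m" "5 \<le> m" "m \<le> n" "hole (Restr R S) (int m) g" .
  with minimal hole_Restr assms(3) show False
    by (metis leD le_trans)
qed

text \<open>The parity argument for stable neighbourhoods: of the two arcs of the hole between two
  neighbours of \<open>v\<close>, the odd one closes up with \<open>v\<close> to an odd closed walk.\<close>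
lemma stable_neighbours:
  assumes hole: "hole R (int L) g"
    and stable: "\<And>i. (v, g i) \<in> R \<Longrightarrow> (v, g (i + 1)) \<in> R \<Longrightarrow> False"
    and v: "(v, g i) \<in> R" "(v, g (i + int d)) \<in> R" "0 < d" "d < L"
  shows "d = 2 \<or> d = L - 2"
proof -
  define S where "S = insert v (range g)"
  define R' where "R' = Restr R S"
  have hole': "hole R' (int L) g"
    unfolding R'_def by (rule hole_RestrI[OF hole]) (auto simp: S_def)
  have nbrs: False if "(g a, g b) \<in> R" "(v, g a) \<in> R" "(v, g b) \<in> R" for a b
  proof -
    have "g a = g (b + 1) \<or> g b = g (a + 1)"
      using that(1) unfolding hole_adj_iff[OF hole] hole_eq_iff[OF hole]
      by (metis diff_diff_eq dvd_minus_iff minus_diff_eq diff_add_eq_diff_diff_swap diff_minus_eq_add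
          add_diff_eq add.commute diff_diff_eq2)
    then show False using stable that by metis
  qed
  have no: "\<not> has_triangle R'"
  proof
    assume "has_triangle R'"
    then obtain x y z where t: "(x, y) \<in> R" "(y, z) \<in> R" "(x, z) \<in> R" "x \<in> S" "y \<in> S" "z \<in> S"
      unfolding has_triangle_def R'_def by blast
    have v_case: False if "(v, y) \<in> R" "(v, z) \<in> R" "(y, z) \<in> R" "y \<in> S" "z \<in> S" for y z
      using that nbrs irreflD unfolding S_def by blast
    show False
    proof (cases "v \<in> {x, y, z}")
      case True
      then show False using t v_case sym_iff by blast
    next
      case False
      then show False using t hole_no_triangle[OF hole] ge_7 sym_iff unfolding S_def by fastforce
    qed
  qed
  have ends: "(v, g i) \<in> R' ^^ 1" "(g (i + int d), v) \<in> R' ^^ 1"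
    "(g i, v) \<in> R' ^^ 1" "(v, g (i + int d)) \<in> R' ^^ 1"
    using v sym_iff unfolding R'_def S_def by auto
  have wrap: "g (i + int d + int (L - d)) = g i"
    unfolding hole_eq_iff[OF hole] using v(4) by (simp add: of_nat_diff)
  have "(v, v) \<in> R' ^^ (1 + d + 1)"
    using relpow_addI[OF relpow_addI[OF ends(1) hole_path[OF hole']] ends(2)] .
  moreover have "(v, v) \<in> R' ^^ (1 + (L - d) + 1)"
    using relpow_addI[OF relpow_addI[OF ends(4) hole_path[OF hole', of _ "L - d"]]] wrap ends(3) by metis
  ultimately have *: "odd (d + 2) \<Longrightarrow> L \<le> d + 2" "odd (L - d + 2) \<Longrightarrow> L \<le> L - d + 2"
    using short_odd_closed_walk[of v _ S] no unfolding R'_def by fastforce+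
  \<comment> \<open>Parity sharpens the bounds: an odd \<open>d\<close> below the odd
    \<open>L\<close> is at most \<open>L - 2\<close>, hence equal to it; for even \<open>d\<close>,
    the other arc leaves only \<open>d = 2\<close>.\<close>
  show ?thesis
  proof (cases "odd d")
    case True
    then show ?thesis using *(1) odd v(4) ge_7 by simp presburger
  next
    case False
    then show ?thesis using *(2) odd v(3,4) ge_7 by simp presburger
  qed
qed

text \<open>If \<open>v\<close> sees no two consecutive vertices, then by
  \<open>stable_neighbours\<close> its neighbours are pairwise at cyclic distance 2, and three of
  them would need a cycle of length 6. If it sees two consecutive ones, a run of neighbours starts
  after some non-neighbour \<open>j\<close>, and bulls around its beginning force the neighbours to
  be exactly \<open>j + 1\<close>, \<open>j + 2\<close>, \<open>j + 3\<close>.\<close>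

lemma clone:
  assumes "clean g" and "(v, g a) \<in> R" "(v, g b) \<in> R" "g a \<noteq> g b"
  obtains c where "(v, g (c - 1)) \<in> R" "(v, g (c + 1)) \<in> R"
    "\<And>j. (v, g j) \<in> R \<Longrightarrow> g j \<in> {g (c - 1), g c, g (c + 1)}"
proof -
  have hole: "hole R (int L) g" and major: "\<exists>i. (v, g i) \<notin> R"
    using assms(1) unfolding clean_def by auto
  note adj = hole_adj_near_iff[OF hole]
  have pos: "0 < int L" using ge_7 by simp
  show thesis
  proof (cases "\<exists>i. (v, g i) \<in> R \<and> (v, g (i + 1)) \<in> R")
    case True
    define P where "P t \<longleftrightarrow> (v, g t) \<in> R \<and> (v, g (t + 1)) \<in> R" for t
    from True obtain i where "P i" unfolding P_def by blast
    \<comment> \<open>Stepping back through consecutive neighbours must stop somewhere, since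
      otherwise periodicity would make \<open>v\<close> complete to the hole.\<close>
    have "\<exists>t. P t \<and> \<not> P (t - 1)"
    proof (rule ccontr)
      assume "\<nexists>t. P t \<and> \<not> P (t - 1)"
      then have pred: "P t \<Longrightarrow> P (t - 1)" for t by blast
      have all: "P (i - int n)" for n
      proof (induction n)
        case (Suc n)
        have "i - int (Suc n) = i - int n - 1" by simp
        then show ?case using pred[OF Suc] by (simp only:)
      qed (use \<open>P i\<close> in simp)
      obtain i0 where "(v, g i0) \<notin> R" using major by blast
      obtain d where d: "0 \<le> d" "d < int L" "g i0 = g (i - int L + d)"
        using hole_obtain_offset[OF hole pos] .
      have "P (i - int L + d)"
        using all[of "nat (int L - d)"] d by (simp add: algebra_simps)
      with d \<open>(v, g i0) \<notin> R\<close> show False unfolding P_def by simp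
    qed
    then obtain t where t: "P t" "\<not> P (t - 1)" by blast
    define j where "j = t - 1"
    have j: "(v, g j) \<notin> R" "(v, g (j + 1)) \<in> R" "(v, g (j + 2)) \<in> R"
      using t unfolding P_def j_def by (simp_all add: algebra_simps)
    have j3: "(v, g (j + 3)) \<in> R"
    proof (rule ccontr)
      assume "(v, g (j + 3)) \<notin> R"
      then show False
        using bull_freeD[of "g (j + 1)" "g (j + 2)" v "g j" "g (j + 3)"] j sym_iff ge_7
        by (simp add: adj)
    qed
    \<comment> \<open>Now the second pendant vertex hangs off \<open>v\<close>. Offsets 4 to
      \<open>L - 2\<close> are those of vertices adjacent to none of \<open>j\<close>,
      \<open>j + 1\<close>, \<open>j + 2\<close>.\<close>
    have far: "(v, g (j + d)) \<notin> R" if "4 \<le> d" "d \<le> int L - 2" for d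
    proof
      assume "(v, g (j + d)) \<in> R"
      then show False
        using bull_freeD[of "g (j + 1)" v "g (j + 2)" "g j" "g (j + d)"] j that sym_iff[of v] ge_7
        by (simp add: adj)
    qed
    \<comment> \<open>This position is adjacent to \<open>j\<close>, so the previous bull fails. Its
      mirror image at the other end of the run works, with \<open>j + 4\<close> as pendant vertex;
      \<open>L \<ge> 7\<close> keeps \<open>j + 4\<close> and \<open>j - 1\<close>
      non-adjacent.\<close>
    have before: "(v, g (j - 1)) \<notin> R"
    proof
      assume "(v, g (j - 1)) \<in> R"
      then show False
        using bull_freeD[of "g (j + 3)" v "g (j + 2)" "g (j + 4)" "g (j - 1)"] j j3 far[of 4] sym_iff[of v] ge_7
        by (simp add: adj)
    qed
    show thesis
    proof (rule that[of "j + 2"])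
      fix k assume k: "(v, g k) \<in> R"
      obtain d where d: "0 \<le> d" "d < int L" "g k = g (j + d)"
        using hole_obtain_offset[OF hole pos] .
      have "g (j + (int L - 1)) = g (j - 1)" by (simp add: hole_eq_iff[OF hole])
      then have "d \<noteq> int L - 1" using d k before by auto
      moreover have "d \<noteq> 0" using d k j by auto
      ultimately have "d = 1 \<or> d = 2 \<or> d = 3" using far[of d] d k by force
      then show "g k \<in> {g (j + 2 - 1), g (j + 2), g (j + 2 + 1)}" using d by (auto simp: add.commute)
    qed (use j j3 in \<open>simp_all add: algebra_simps\<close>)
  next
    case False
    have gap: "d = 2 \<or> d = int L - 2" if "(v, g i) \<in> R" "(v, g (i + d)) \<in> R" "0 < d" "d < int L" for i d
      using stable_neighbours[OF hole, of v i "nat d"] False that ge_7 by (auto simp: nat_eq_iff)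
    obtain d where d: "0 \<le> d" "d < int L" "g b = g (a + d)"
      using hole_obtain_offset[OF hole pos] .
    have "d \<noteq> 0" using d assms(4) by auto
    then have "d = 2 \<or> d = int L - 2" using gap[of a d] assms d by auto
    then obtain c where c: "(v, g (c - 1)) \<in> R" "(v, g (c + 1)) \<in> R"
    proof
      assume "d = 2"
      then show thesis using that[of "a + 1"] assms d by (simp add: algebra_simps)
    next
      assume "d = int L - 2"
      moreover have "g (a + (int L - 2)) = g (a - 1 - 1)" by (simp add: hole_eq_iff[OF hole])
      ultimately show thesis using that[of "a - 1"] assms d by simp
    qed
    show thesis
    proof (rule that[OF c])
      fix k assume k: "(v, g k) \<in> R"
      obtain e where e: "0 \<le> e" "e < int L" "g k = g (c - 1 + e)"
        using hole_obtain_offset[OF hole pos] .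
      consider "e = 0" | "e = 2" | "e = int L - 2"
        using gap[of "c - 1" e] e k c by force
      then show "g k \<in> {g (c - 1), g c, g (c + 1)}"
      proof cases
        case 3
        have "c + 1 + (int L - 4) = c - 1 + e" using 3 by simp
        then have "g (c + 1 + (int L - 4)) = g (c - 1 + e)" by (simp only:)
        then show ?thesis
          using gap[of "c + 1" "int L - 4"] c k e ge_7 by simp
      qed (use e in \<open>auto simp: add.commute\<close>)
    qed
  qed
qed

text \<open>The new hole is again clean because a vertex complete to it would see
  \<open>g (c + 1)\<close> to \<open>g (c + 4)\<close>, which the exchange leaves in place, while
  \<open>clone\<close> permits at most three neighbours on \<open>g\<close>.\<close>

lemma replace_clone:
  assumes "clean g" "v \<notin> range g" "(v, g (c - 1)) \<in> R" "(v, g (c + 1)) \<in> R"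
    "\<And>j. (v, g j) \<in> R \<Longrightarrow> g j \<in> {g (c - 1), g c, g (c + 1)}"
  shows "clean (\<lambda>j. if int L dvd j - c then v else g j)"
proof -
  define g' where "g' = (\<lambda>j. if int L dvd j - c then v else g j)"
  have hole: "hole R (int L) g"
    using assms(1) unfolding clean_def by auto
  have nbr: "(v, g j) \<in> R \<longleftrightarrow> int L dvd c - j - 1 \<or> int L dvd c - j + 1" if "\<not> int L dvd j - c" for j
  proof -
    have "(v, g j) \<in> R \<longleftrightarrow> g (c - 1) = g j \<or> g (c + 1) = g j"
      using assms(3-5) that hole_eq_iff[OF hole, of j c] by fastforce
    then show ?thesis
      unfolding hole_eq_iff[OF hole] by (simp add: algebra_simps)
  qed
  have shift: "int L dvd i - j + t \<longleftrightarrow> int L dvd c - j + t" if "int L dvd i - c" for i j t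
    using that dvd_add_right_iff[of "int L" "i - c" "c - j + t"] by (simp add: algebra_simps)
  have flip: "int L dvd j - c \<longleftrightarrow> int L dvd c - j" for j
    by (metis dvd_minus_iff minus_diff_eq)
  have eq: "g' i = g' j \<longleftrightarrow> int L dvd i - j" for i j
  proof (cases "int L dvd i - c")
    case True
    then show ?thesis
      using shift[OF True, of j 0] flip[of j] assms(2) unfolding g'_def by auto
  next
    case False
    then show ?thesis
      using shift[of j i 0] flip[of "i - j + c"] flip[of i] assms(2) hole_eq_iff[OF hole]
      unfolding g'_def by (auto simp: algebra_simps)
  qed
  have half: "(v, g' j) \<in> R \<longleftrightarrow> int L dvd i - j - 1 \<or> int L dvd i - j + 1" if "int L dvd i - c" for i j
  proof (cases "int L dvd j - c")
    case True
    then have "int L dvd c - j" using flip by blast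
    then have "\<not> int L dvd c - j + t" if "t = 1 \<or> t = -1" for t
      using that ge_7 dvd_small_iff[of t "int L"] dvd_add_right_iff[of "int L" "c - j" t] by auto
    from this[of 1] this[of "-1"] show ?thesis
      using True shift[OF that, of j 1] shift[OF that, of j "-1"] irreflD unfolding g'_def by auto
  next
    case False
    then show ?thesis
      using nbr[OF False] shift[OF that, of j 1] shift[OF that, of j "-1"] unfolding g'_def by auto
  qed
  have "(g' i, g' j) \<in> R \<longleftrightarrow> int L dvd i - j - 1 \<or> int L dvd i - j + 1" for i j
  proof (cases "int L dvd i - c")
    case True
    then show ?thesis using half[OF True] unfolding g'_def by simp
  next
    case i: False
    show ?thesis
    proof (cases "int L dvd j - c")
      case True
      have "(g' i, g' j) \<in> R \<longleftrightarrow> (v, g' i) \<in> R"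
        using True sym_iff unfolding g'_def by auto
      also have "\<dots> \<longleftrightarrow> int L dvd j - i - 1 \<or> int L dvd j - i + 1"
        using half[OF True] .
      also have "\<dots> \<longleftrightarrow> int L dvd i - j - 1 \<or> int L dvd i - j + 1"
        using dvd_minus_iff[of "int L" "i - j - 1"] dvd_minus_iff[of "int L" "i - j + 1"]
        by (auto simp: algebra_simps)
      finally show ?thesis .
    next
      case False
      then show ?thesis using i hole_adj_iff[OF hole] unfolding g'_def by auto
    qed
  qed
  then have "hole R (int L) g'" using eq unfolding hole_def by blast
  moreover have "\<exists>i. (z, g' i) \<notin> R" for z
  proof (rule ccontr)
    assume "\<nexists>i. (z, g' i) \<notin> R"
    then have all: "(z, g' i) \<in> R" for i by blast
    have z: "(z, g (c + t)) \<in> R" if "1 \<le> t" "t \<le> 4" for t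
      using all[of "c + t"] that ge_7 dvd_small_iff[of t "int L"] unfolding g'_def by auto
    have ne: "g (c + s) \<noteq> g (c + t)" if "1 \<le> s" "s < t" "t \<le> 4" for s t
      using that ge_7 dvd_small_iff[of "s - t" "int L"] unfolding hole_eq_iff[OF hole] by simp
    obtain c' where "\<And>j. (z, g j) \<in> R \<Longrightarrow> g j \<in> {g (c' - 1), g c', g (c' + 1)}"
      using clone[OF assms(1) z[of 1] z[of 2] ne[of 1 2]] by auto
    from this[OF z[of 1]] this[OF z[of 2]] this[OF z[of 3]] this[OF z[of 4]] show False
      using ne[of 1 2] ne[of 1 3] ne[of 1 4] ne[of 2 3] ne[of 2 4] ne[of 3 4] by auto
  qed
  ultimately show ?thesis unfolding clean_def g'_def by blast
qed

section \<open>Clean holes are isometric\<close>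

text \<open>Cyclic distance at most \<open>m\<close>, phrased for vertices because indices are
  determined only modulo \<open>L\<close>. The sign of \<open>d\<close> selects the arc.\<close>

definition near :: "(int \<Rightarrow> 'a) \<Rightarrow> nat \<Rightarrow> 'a \<Rightarrow> 'a \<Rightarrow> bool" where
  "near g m x y \<longleftrightarrow> (\<exists>i d. \<bar>d\<bar> \<le> int m \<and> x = g i \<and> y = g (i + d))"

lemma near_mono: "near g m x y \<Longrightarrow> m \<le> m' \<Longrightarrow> near g m' x y"
  unfolding near_def by force

lemma near_sym: "near g m x y \<Longrightarrow> near g m y x"
proof -
  assume "near g m x y"
  then obtain i d where "\<bar>d\<bar> \<le> int m" "x = g i" "y = g (i + d)"
    unfolding near_def by blast
  then show "near g m y x"
    unfolding near_def by (intro exI[of _ "i + d"] exI[of _ "- d"]) simp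
qed

lemma near_trans:
  assumes "hole R (int L) g" "near g m x y" "near g m' y z"
  shows "near g (m + m') x z"
proof -
  obtain i d j e where *: "\<bar>d\<bar> \<le> int m" "x = g i" "y = g (i + d)" "\<bar>e\<bar> \<le> int m'" "y = g j" "z = g (j + e)"
    using assms(2,3) unfolding near_def by blast
  then have "z = g (i + (d + e))"
    using hole_shift[OF assms(1), of "i + d" j e] by (simp add: add.assoc)
  with * show ?thesis
    unfolding near_def by (intro exI[of _ i] exI[of _ "d + e"]) auto
qed

text \<open>Brings a distance measured on the exchanged hole back to \<open>g\<close>: there
  \<open>v\<close> occupies exactly the positions that \<open>g c\<close> has on \<open>g\<close>,
  and \<open>x\<close> keeps its own.\<close>

lemma near_clone:
  assumes "near (\<lambda>j. if int L dvd j - c then v else g j) m x v" "hole R (int L) g"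
    "v \<notin> range g" "x \<in> range g"
  shows "near g m x (g c)"
proof -
  define g' where "g' = (\<lambda>j. if int L dvd j - c then v else g j)"
  obtain i d where *: "\<bar>d\<bar> \<le> int m" "x = g' i" "v = g' (i + d)"
    using assms(1) unfolding near_def g'_def by blast
  then have "int L dvd i + d - c" "x = g i"
    using assms(3,4) unfolding g'_def by (auto split: if_splits)
  then show ?thesis
    using * hole_eq_iff[OF assms(2), of "i + d" c] unfolding near_def by metis
qed

text \<open>The induction hypothesis ranges over all clean holes of length \<open>L\<close>, since a vertex \<open>q i\<close> with two neighbours on \<open>g\<close> is moved onto the hole by
  exchanging it with the vertex it clones.\<close>
lemma isometric:
  "clean g \<Longrightarrow> u \<in> range g \<Longrightarrow> v \<in> range g \<Longrightarrow> (u, v) \<in> R ^^ m \<Longrightarrow> near g m u v"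
proof (induction m arbitrary: g u v rule: less_induct)
  case (less m)
  have hole: "hole R (int L) g"
    using less.prems(1) unfolding clean_def by blast
  note eq_iff = hole_eq_iff[OF hole] and adj_iff = hole_adj_iff[OF hole]
  show ?case
  proof (rule ccontr)
    assume far: "\<not> near g m u v"
    \<comment> \<open>So the walk is a geodesic: a shorter connection would be covered by the
      induction hypothesis.\<close>
    have short: "(u, v) \<notin> R ^^ k" if "k < m" for k
      using less.IH[OF that less.prems(1-3)] near_mono[of g k u v m] that far by auto
    obtain q where q: "q 0 = u" "q m = v" "\<forall>i<m. (q i, q (Suc i)) \<in> R"
      using less.prems(4) unfolding relpow_fun_conv by blast
    have seg: "(q i, q j) \<in> R ^^ (j - i)" if "i \<le> j" "j \<le> m" for i j
      using relpow_segment[OF q(3) that] .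
    have head: "(u, q i) \<in> R ^^ i" "(q i, v) \<in> R ^^ (m - i)" if "i \<le> m" for i
      using seg[of 0 i] seg[of i m] that q by auto
    have step: "(q i, q (i + 1)) \<in> R" if "i < m" for i
      using q(3) that by simp
    have detour: "j \<le> i + k" if "(q i, q j) \<in> R ^^ k" "i \<le> m" "j \<le> m" for i j k
    proof (rule ccontr)
      assume "\<not> j \<le> i + k"
      then have "(u, v) \<in> R ^^ (i + k + (m - j))" "i + k + (m - j) < m"
        using relpow_addI[OF relpow_addI[OF head(1)[of i] that(1)] head(2)[of j]] that by auto
      then show False using short by blast
    qed
    have chord: "j \<le> i + 1 \<and> i \<le> j + 1" if "(q i, q j) \<in> R" "i \<le> m" "j \<le> m" for i j
      using detour[of i j 1] detour[of j i 1] that sym_iff by auto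
    \<comment> \<open>A hole vertex inside the path would split it into two shorter walks, and the
      bounds for the halves add up.\<close>
    have avoid: "q i \<notin> range g" if "0 < i" "i < m" for i
    proof
      assume on: "q i \<in> range g"
      have "near g i u (q i)"
        using less.IH[OF that(2) less.prems(1,2) on] head(1)[of i] that by simp
      moreover have "near g (m - i) (q i) v"
        using less.IH[OF _ less.prems(1) on less.prems(3)] head(2)[of i] that by simp
      ultimately have "near g (i + (m - i)) u v"
        using near_trans[OF hole] by blast
      with far that show False by simp
    qed
    \<comment> \<open>Otherwise \<open>q i\<close> is a clone of some \<open>g c\<close>. After the
      exchange it lies on the hole, both halves of the path fall under the induction hypothesis, and
      back on \<open>g\<close> they bound the distances of \<open>u\<close> and \<open>v\<close>
      from \<open>g c\<close>.\<close>
    have unique: "x = y" if i: "0 < i" "i < m"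
      and xy: "x \<in> range g" "y \<in> range g" "(q i, x) \<in> R" "(q i, y) \<in> R" for i x y
    proof (rule ccontr)
      assume "x \<noteq> y"
      then obtain c where c: "(q i, g (c - 1)) \<in> R" "(q i, g (c + 1)) \<in> R"
        "\<And>j. (q i, g j) \<in> R \<Longrightarrow> g j \<in> {g (c - 1), g c, g (c + 1)}"
        using clone[OF less.prems(1), of "q i"] xy by auto
      define g' where "g' = (\<lambda>j. if int L dvd j - c then q i else g j)"
      have clean': "clean g'"
        unfolding g'_def by (rule replace_clone[OF less.prems(1) avoid[OF i] c])
      have qi: "q i \<in> range g'"
        unfolding g'_def by (auto intro: image_eqI[of _ _ c])
      have to_c: "near g k z (g c)" if z: "z \<in> range g" "k < m" "(z, q i) \<in> R ^^ k" for z k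
      proof (cases "z = g c")
        case True
        then show ?thesis unfolding near_def by (intro exI[of _ c] exI[of _ 0]) simp
      next
        case False
        obtain j where "z = g j" using z(1) by blast
        then have "z = g' j" using False eq_iff[of j c] unfolding g'_def by auto
        then have "near g' k z (q i)" using less.IH[OF z(2) clean' _ qi z(3)] by blast
        then show ?thesis
          unfolding g'_def using near_clone[OF _ hole avoid[OF i] z(1)] by blast
      qed
      have "near g i u (g c)" "near g (m - i) v (g c)"
        using to_c[of u i] to_c[of v "m - i"] less.prems(2,3) i head[of i] relpow_sym[OF sym] by auto
      then have "near g (i + (m - i)) u v"
        using near_trans[OF hole] near_sym by blast
      with far i show False by simp
    qed
    define S where "S = range g \<union> q ` {0<..<m}"
    define R' where "R' = Restr R S"
    have q_S: "q i \<in> S" if "i \<le> m" for i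
      using that less.prems(2,3) q(1,2) unfolding S_def by (cases "i = 0 \<or> i = m") auto
    have "(q i, q (Suc i)) \<in> R'" if "i < m" for i
      using step[OF that] q_S that unfolding R'_def by auto
    then have uv: "(u, v) \<in> R' ^^ m"
      using q(1,2) unfolding relpow_fun_conv by blast
    have hole': "hole R' (int L) g"
      unfolding R'_def by (rule hole_RestrI[OF hole]) (auto simp: S_def)
    obtain i0 where i0: "u = g i0" using less.prems(2) by blast
    obtain d where d: "0 \<le> d" "d < int L" "v = g (i0 + d)"
      using hole_obtain_offset[OF hole, of _ i0] less.prems(3) ge_7
      by (metis (no_types, lifting) of_nat_0_less_iff imageE le_trans less_le_trans zero_less_numeral)
    \<comment> \<open>Since \<open>u\<close> and \<open>v\<close> are not near, both arcs between
      them, of lengths \<open>d\<close> and \<open>L - d\<close>, are longer than the path.\<close>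
    have "int m < d"
      using far i0 d unfolding near_def by force
    have wrap: "v = g (i0 + (d - int L))"
      unfolding d(3) eq_iff by simp
    have "int m < int L - d"
    proof (rule ccontr)
      assume "\<not> int m < int L - d"
      then have "near g m u v"
        using i0 d(2) wrap unfolding near_def by (intro exI[of _ i0] exI[of _ "d - int L"]) simp
      with far show False by simp
    qed
    have "(u, v) \<in> R' ^^ nat d"
      using hole_path[OF hole', of i0 "nat d"] i0 d by simp
    then have walk1: "(u, u) \<in> R' ^^ (m + nat d)"
      using relpow_addI[OF uv] relpow_sym[of R'] sym unfolding R'_def sym_def by blast
    have "(v, u) \<in> R' ^^ nat (int L - d)"
      using hole_path[OF hole', of "i0 + (d - int L)" "nat (int L - d)"] i0 d wrap by simp
    then have walk2: "(u, u) \<in> R' ^^ (m + nat (int L - d))"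
      using relpow_addI[OF uv] by blast
    \<comment> \<open>The arcs have opposite parity, so the path closes up with one of them to an
      odd closed walk; being shorter than the other arc, it keeps this walk shorter than
      \<open>L\<close>.\<close>
    have "has_triangle R'"
    proof (cases "odd (m + nat d)")
      case True
      then show ?thesis
        using short_odd_closed_walk[of u "m + nat d" S] walk1 \<open>int m < int L - d\<close> d
        unfolding R'_def by linarith
    next
      case False
      have "nat (int L - d) = L - nat d" "nat d < L" using d by auto
      then have "odd (m + nat (int L - d))"
        using False odd by (simp add: even_diff_nat)
      then show ?thesis
        using short_odd_closed_walk[of u "m + nat (int L - d)" S] walk2 \<open>int m < d\<close> d
        unfolding R'_def by linarith
    qed
    then obtain x y z where xyz: "(x, y) \<in> R" "(y, z) \<in> R" "(x, z) \<in> R" "x \<in> S" "y \<in> S" "z \<in> S"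
      unfolding has_triangle_def R'_def by blast
    have two: False if R: "(x, y) \<in> R" "(x, z) \<in> R" "(y, z) \<in> R"
      and xyz: "x \<in> range g" "y \<in> range g" "z \<in> S" for x y z
    proof (cases "z \<in> range g")
      case True
      then obtain i j k where "x = g i" "y = g j" "z = g k" using xyz by blast
      then show False
        using R hole_no_triangle[OF hole, of i j k] ge_7 sym_iff[of x z] by simp
    next
      case False
      then obtain i where "0 < i" "i < m" "z = q i" using xyz(3) unfolding S_def by auto
      then have "x = y" using unique[of i x y] R(2,3) xyz(1,2) sym_iff by blast
      then show False using R(1) irreflD by blast
    qed
    have none: False if R: "(x, y) \<in> R" "(x, z) \<in> R" "(y, z) \<in> R"
      and q: "x \<in> q ` {0<..<m}" "y \<in> q ` {0<..<m}" "z \<in> q ` {0<..<m}" for x y z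
    proof -
      obtain i j k where ijk: "x = q i" "y = q j" "z = q k" "i < m" "j < m" "k < m"
        using q by auto
      then have "i \<noteq> j" "i \<noteq> k" "j \<noteq> k" using R irreflD by auto
      then show False
        using chord[of i j] chord[of i k] chord[of j k] R ijk by simp
    qed
    \<comment> \<open>The triangle has exactly one vertex on the hole: two are excluded by
      uniqueness of the hole neighbour, none by the path being a geodesic.\<close>
    have "\<exists>c a b. c \<in> range g \<and> a \<in> q ` {0<..<m} \<and> b \<in> q ` {0<..<m} \<and> (c, a) \<in> R \<and> (c, b) \<in> R \<and> (a, b) \<in> R"
    proof -
      have neg: "w \<in> q ` {0<..<m}" if "w \<in> S" "w \<notin> range g" for w using that unfolding S_def by blast
      have flip: "(y, x) \<in> R" "(z, y) \<in> R" "(z, x) \<in> R" using xyz(1-3) sym_iff by blast+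
      show ?thesis
        using xyz flip neg[OF xyz(4)] neg[OF xyz(5)] neg[OF xyz(6)]
          two[of x y z] two[of x z y] two[of y z x] none[of x y z] by blast
    qed
    then obtain c x y where "c \<in> range g" "x \<in> q ` {0<..<m}" "y \<in> q ` {0<..<m}"
      "(c, x) \<in> R" "(c, y) \<in> R" "(x, y) \<in> R"
      by blast
    then obtain a b where cab: "c \<in> range g" "0 < a" "a < m" "0 < b" "b < m" "(c, q a) \<in> R" "(c, q b) \<in> R" "(q a, q b) \<in> R"
      by auto
    have "a \<noteq> b" using cab irreflD by auto
    have "\<exists>i. 0 < i \<and> i + 1 < m \<and> (c, q i) \<in> R \<and> (c, q (i + 1)) \<in> R"
    proof (cases "a < b")
      case True
      then have "b = a + 1" using chord[OF cab(8)] cab by simp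
      then show ?thesis using cab by auto
    next
      case False
      then have "a = b + 1" using chord[OF cab(8)] cab \<open>a \<noteq> b\<close> by simp
      then show ?thesis using cab by auto
    qed
    then obtain i where i: "0 < i" "i + 1 < m" "(q i, c) \<in> R" "(q (i + 1), c) \<in> R"
      using sym_iff by blast
    \<comment> \<open>At the ends of the path, uniqueness would identify \<open>c\<close> with
      \<open>u\<close> or \<open>v\<close>, and the triangle would contain a chord of the geodesic.
      Hence \<open>q (i - 1)\<close> and \<open>q (i + 2)\<close> are interior too.\<close>
    have "i \<noteq> 1"
    proof
      assume "i = 1"
      then have "c = u"
        using unique[of 1 c u] i cab(1) less.prems(2) step[of 0] q(1) sym_iff by simp
      then show False
        using chord[of "i + 1" 0] i \<open>i = 1\<close> q(1) by simp
    qed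
    have "i + 2 \<noteq> m"
    proof
      assume "i + 2 = m"
      then have "c = v"
        using unique[of "i + 1" c v] i cab(1) less.prems(3) step[of "i + 1"] q(2) by simp
      then show False
        using chord[of i m] i \<open>i + 2 = m\<close> q(2) by simp
    qed
    \<comment> \<open>The triangle is \<open>q k\<close>, \<open>c\<close>, \<open>q l\<close>, with
      \<open>q j\<close> pendant at \<open>q k\<close>. The other pendant vertex is a hole neighbour
      of \<open>c\<close>: there are two, and \<open>q j\<close> sees at most one of them, while
      \<open>q k\<close> and \<open>q l\<close> have \<open>c\<close> as their only neighbour on the
      hole.\<close>
    have bull: False if j: "0 < j" "j < m" and that: "(q j, q k) \<in> R" "(q k, q l) \<in> R" "(q k, c) \<in> R" "(q l, c) \<in> R"
      "0 < k" "k < m" "0 < l" "l < m" "(q j, c) \<notin> R" "(q j, q l) \<notin> R" for j k l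
    proof -
      obtain t where t: "c = g t" using cab(1) by blast
      have ne: "g (t - 1) \<noteq> g (t + 1)"
        unfolding eq_iff using ge_7 dvd_small_iff[of "-2" "int L"] by simp
      obtain s where s: "s \<in> range g" "(c, s) \<in> R" "(q j, s) \<notin> R"
      proof (cases "(q j, g (t - 1)) \<in> R")
        case True
        then have "(q j, g (t + 1)) \<notin> R" using unique[OF j, of "g (t - 1)" "g (t + 1)"] ne by blast
        then show thesis using that[of "g (t + 1)"] t adj_iff by simp
      next
        case False
        then show thesis using that[of "g (t - 1)"] t adj_iff by simp
      qed
      have "s \<noteq> c" using s irreflD by auto
      then have "(q k, s) \<notin> R" "(q l, s) \<notin> R"
        using unique[of k s c] unique[of l s c] that s(1) cab(1) by blast+
      then show False
        using bull_freeD[of "q k" c "q l" "q j" s] that s sym_iff by blast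
    qed
    show False
    proof (cases "(q (i - 1), c) \<in> R")
      case False
      moreover have "i - 1 < m" using i(2) by simp
      ultimately show False
        using bull[of "i - 1" i "i + 1"] i step[of "i - 1"] step[of i] chord[of "i - 1" "i + 1"] \<open>i \<noteq> 1\<close>
        by auto
    next
      case True
      \<comment> \<open>Both outer vertices cannot see \<open>c\<close>, for then \<open>c\<close>
        would shortcut three steps of the geodesic to two. So the bull exists at one of the two
        ends.\<close>
      have "(q (i + 2), c) \<notin> R"
      proof
        assume "(q (i + 2), c) \<in> R"
        then have "(q (i - 1), q (i + 2)) \<in> R ^^ 2"
          using True sym_iff by (auto simp: numeral_2_eq_2)
        moreover have "i - 1 \<le> m" using i(2) by simp
        ultimately show False
          using detour[of "i - 1" "i + 2" 2] i \<open>i + 2 \<noteq> m\<close> by simp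
      qed
      moreover have "(q (i + 2), q (i + 1)) \<in> R" "(q (i + 1), q i) \<in> R"
        using step[of "i + 1"] step[of i] i(2) sym_iff by auto
      moreover have "(q (i + 2), q i) \<notin> R"
        using chord[of "i + 2" i] i(2) by auto
      ultimately show False
        using bull[of "i + 2" "i + 1" i] i \<open>i + 2 \<noteq> m\<close> by simp
    qed
  qed
qed

end

section \<open>The apex criterion\<close>

definition level :: "('a \<times> 'a) set \<Rightarrow> 'a \<Rightarrow> nat \<Rightarrow> 'a \<Rightarrow> bool" where
  "level R c t x \<longleftrightarrow> (c, x) \<in> R ^^ t \<and> (\<forall>j<t. (c, x) \<notin> R ^^ j)"

definition without_common :: "('a \<times> 'a) set \<Rightarrow> 'a \<Rightarrow> 'a \<Rightarrow> ('a \<times> 'a) set" where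
  "without_common R c d = Restr R {v. \<not> ((c, v) \<in> R \<and> (d, v) \<in> R)}"

text \<open>Here \<open>Suc j\<close> is the distance of the apex. The bound \<open>j < N\<close>
  keeps it within the \<open>N\<close> layers that the search explores beyond the source.\<close>

definition apex_witness :: "('a \<times> 'a) set \<Rightarrow> nat \<Rightarrow> 'a \<Rightarrow> 'a \<Rightarrow> bool" where
  "apex_witness R N c d \<longleftrightarrow> (\<exists>j<N. \<exists>w a b. level R c (Suc j) w \<and> level R d (Suc j) w \<and>
     level R c j a \<and> level R d (Suc j) a \<and> level R c (Suc j) b \<and> level R d j b \<and>
     (a, w) \<in> R \<and> (w, b) \<in> R \<and> (a, b) \<notin> R)"

lemma level_step: "level R c s x \<Longrightarrow> level R c t y \<Longrightarrow> (x, y) \<in> R \<Longrightarrow> t \<le> Suc s"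
  unfolding level_def by (meson not_less relpow_Suc_I)

lemma level_unique: "level R c s x \<Longrightarrow> level R c t x \<Longrightarrow> s = t"
  unfolding level_def by (meson linorder_neqE_nat)

lemma level_pred:
  assumes "level R c (Suc t) y" "(c, x) \<in> R ^^ t" "(x, y) \<in> R"
  shows "level R c t x"
  using assms unfolding level_def by (meson Suc_less_eq relpow_Suc_I)

lemma level_along_geodesic:
  assumes "\<forall>i<t. (p i, p (Suc i)) \<in> R" "level R c t (p t)" "p 0 = c" "i \<le> t"
  shows "level R c i (p i)"
proof -
  have "(c, p i) \<in> R ^^ i" "(p i, p t) \<in> R ^^ (t - i)"
    using relpow_segment[OF assms(1), of 0 i] relpow_segment[OF assms(1), of i t] assms(3,4) by auto
  moreover have "(c, p i) \<notin> R ^^ j" if "j < i" for j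
  proof
    assume "(c, p i) \<in> R ^^ j"
    then have "(c, p t) \<in> R ^^ (j + (t - i))"
      using relpow_addI calculation(2) by metis
    then show False
      using assms(2,4) that unfolding level_def by auto
  qed
  ultimately show ?thesis unfolding level_def by blast
qed

text \<open>The walk that starts with the edge from \<open>d\<close> to \<open>c\<close> and then
  follows \<open>p\<close> is itself a geodesic, since a shortcut to \<open>p i\<close> could be
  prolonged to \<open>p t\<close>.\<close>

lemma level_other_end:
  assumes "\<forall>i<t. (p i, p (Suc i)) \<in> R" "level R d (Suc t) (p t)" "p 0 = c" "(d, c) \<in> R" "i \<le> t"
  shows "level R d (Suc i) (p i)"
proof -
  have "(d, p i) \<in> R ^^ Suc i"
    using relpow_segment[OF assms(1), of 0 i] assms(3,5) relpow_Suc_I2[OF assms(4), of "p i" i]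
    by (metis diff_zero le0)
  moreover have "(d, p i) \<notin> R ^^ j" if "j < Suc i" for j
  proof
    assume "(d, p i) \<in> R ^^ j"
    then have "(d, p t) \<in> R ^^ (j + (t - i))"
      using relpow_addI[OF _ relpow_segment[OF assms(1), of i t]] assms(5) by simp
    then show False
      using assms(2,5) that unfolding level_def by auto
  qed
  ultimately show ?thesis unfolding level_def by blast
qed

text \<open>The pair of distances from \<open>c\<close> and \<open>d\<close> is
  \<open>(i, i + 1)\<close> on \<open>p i\<close>, \<open>(i + 1, i)\<close> on \<open>q i\<close>
  and \<open>(j + 1, j + 1)\<close> on \<open>w\<close>, and along an edge each entry changes by at
  most one. So the \<open>p i\<close> are adjacent only for consecutive indices, likewise the
  \<open>q i\<close>; \<open>p i\<close> and \<open>q k\<close> only for \<open>i = k\<close>; and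
  \<open>w\<close> sees only \<open>a\<close> and \<open>b\<close> among them. The closed walk has
  length \<open>2 * j + 3\<close>.\<close>

lemma odd_hole_if_apex_witness:
  assumes "sym R" "irrefl R" "(c, d) \<in> R" "apex_witness R N c d"
  obtains m g where "odd m" "5 \<le> m" "hole R (int m) g"
proof -
  obtain j w a b where w: "level R c (Suc j) w" "level R d (Suc j) w"
    and a: "level R c j a" "level R d (Suc j) a" and b: "level R c (Suc j) b" "level R d j b"
    and adj: "(a, w) \<in> R" "(w, b) \<in> R" "(a, b) \<notin> R"
    using assms(4) unfolding apex_witness_def by blast
  have dc: "(d, c) \<in> R" using assms(1,3) by (meson symD)
  obtain p where p: "p 0 = c" "p j = a" "\<forall>i<j. (p i, p (Suc i)) \<in> R"
    using a(1) unfolding level_def relpow_fun_conv by blast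
  obtain q where q: "q 0 = d" "q j = b" "\<forall>i<j. (q i, q (Suc i)) \<in> R"
    using b(2) unfolding level_def relpow_fun_conv by blast
  have lp: "level R c i (p i)" "level R d (Suc i) (p i)" if "i \<le> j" for i
    using level_along_geodesic[OF p(3) _ p(1) that] level_other_end[OF p(3) _ p(1) dc that] a p(2) by auto
  have lq: "level R d i (q i)" "level R c (Suc i) (q i)" if "i \<le> j" for i
    using level_along_geodesic[OF q(3) _ q(1) that] level_other_end[OF q(3) _ q(1) assms(3) that] b q(2) by auto
  define S where "S = insert w (p ` {..j} \<union> q ` {..j})"
  define R' where "R' = Restr R S"
  have sym': "sym R'" and irr': "irrefl R'"
    using assms(1,2) unfolding R'_def sym_def irrefl_def by auto
  have "(p 0, p j) \<in> R' ^^ j" "(q 0, q j) \<in> R' ^^ j"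
    using relpow_segment[of j p R' 0 j] relpow_segment[of j q R' 0 j] p(3) q(3) unfolding R'_def S_def by auto
  moreover have "(q 0, p 0) \<in> R' ^^ 1" "(p j, w) \<in> R' ^^ 1" "(w, q j) \<in> R' ^^ 1"
    using dc adj p q unfolding R'_def S_def by auto
  ultimately have walk: "(w, w) \<in> R' ^^ (1 + j + 1 + j + 1)"
    using relpow_sym[OF sym'] by (meson relpow_addI)
  have no: "\<not> has_triangle R'"
  proof
    assume "has_triangle R'"
    then obtain x y z where xyz: "(x, y) \<in> R" "(y, z) \<in> R" "(x, z) \<in> R" "x \<in> S" "y \<in> S" "z \<in> S"
      unfolding has_triangle_def R'_def by blast
    have irr: "(x, x) \<notin> R" for x using assms(2) unfolding irrefl_def by blast
    have sym_iff: "(x, y) \<in> R \<longleftrightarrow> (y, x) \<in> R" for x y using assms(1) by (meson symD)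
    have pp: "i \<noteq> k \<and> i \<le> Suc k \<and> k \<le> Suc i" if "(p i, p k) \<in> R" "i \<le> j" "k \<le> j" for i k
      using level_step[OF lp(1) lp(1), of i k] level_step[OF lp(1) lp(1), of k i] that irr sym_iff by auto
    have qq: "i \<noteq> k \<and> i \<le> Suc k \<and> k \<le> Suc i" if "(q i, q k) \<in> R" "i \<le> j" "k \<le> j" for i k
      using level_step[OF lq(1) lq(1), of i k] level_step[OF lq(1) lq(1), of k i] that irr sym_iff by auto
    have pq: "i = k" if "(p i, q k) \<in> R" "i \<le> j" "k \<le> j" for i k
      using level_step[OF lp(1) lq(2), of i k] level_step[OF lq(1) lp(2), of k i] that sym_iff by auto
    have pw: "i = j" if "(p i, w) \<in> R" "i \<le> j" for i
      using level_step[OF lp(1) w(1), of i] that by auto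
    have qw: "i = j" if "(q i, w) \<in> R" "i \<le> j" for i
      using level_step[OF lq(1) w(2), of i] that by auto
    have two: False
      if R: "(x, y) \<in> R" "(x, z) \<in> R" "(y, z) \<in> R"
        and xyz: "x \<in> f ` {..j}" "y \<in> f ` {..j}" "z \<in> S"
        and f: "f = p \<and> h = q \<or> f = q \<and> h = p" for x y z f h
    proof -
      have ff: "i \<noteq> k \<and> i \<le> Suc k \<and> k \<le> Suc i" if "(f i, f k) \<in> R" "i \<le> j" "k \<le> j" for i k
        using f pp qq that by blast
      have fh: "i = k" if "(f i, h k) \<in> R" "i \<le> j" "k \<le> j" for i k
        using f pq sym_iff that by blast
      have fw: "i = j" if "(f i, w) \<in> R" "i \<le> j" for i
        using f pw qw that by blast
      obtain i k where ik: "x = f i" "y = f k" "i \<le> j" "k \<le> j" using xyz(1,2) by auto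
      consider "z = w" | l where "z = f l" "l \<le> j" | l where "z = h l" "l \<le> j"
        using xyz(3) f unfolding S_def by auto
      then show False
      proof cases
        case 1
        then show False using ff[of i k] fw[of i] fw[of k] R ik by simp
      next
        case (2 l)
        then have "i \<noteq> k \<and> i \<le> Suc k \<and> k \<le> Suc i" "i \<noteq> l \<and> i \<le> Suc l \<and> l \<le> Suc i"
          "k \<noteq> l \<and> k \<le> Suc l \<and> l \<le> Suc k"
          using ff R ik by blast+
        then show False by linarith
      next
        case (3 l)
        then show False using ff[of i k] fh[of i l] fh[of k l] R ik by simp
      qed
    qed
    have two_p: False if "(x, y) \<in> R" "(x, z) \<in> R" "(y, z) \<in> R" "x \<in> p ` {..j}" "y \<in> p ` {..j}" "z \<in> S" for x y z
      using two[of x y z p q] that by blast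
    have two_q: False if "(x, y) \<in> R" "(x, z) \<in> R" "(y, z) \<in> R" "x \<in> q ` {..j}" "y \<in> q ` {..j}" "z \<in> S" for x y z
      using two[of x y z q p] that by blast
    \<comment> \<open>The last possible triangle is \<open>a\<close>, \<open>b\<close>,
      \<open>w\<close>; this is where the non-adjacency of \<open>a\<close> and \<open>b\<close>
      enters.\<close>
    have one_each: False if "(x, y) \<in> R" "(x, w) \<in> R" "(y, w) \<in> R" "x \<in> p ` {..j}" "y \<in> q ` {..j}" for x y
      using that pw qw adj(3) p(2) q(2) by auto
    have flip: "(y, x) \<in> R" "(z, y) \<in> R" "(z, x) \<in> R" using xyz(1-3) sym_iff by blast+
    have S_cases: "v = w \<or> v \<in> p ` {..j} \<or> v \<in> q ` {..j}" if "v \<in> S" for v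
      using that unfolding S_def by blast
    have "(v, v) \<notin> R" for v using irr .
    then show False
      using xyz flip S_cases[OF xyz(4)] S_cases[OF xyz(5)] S_cases[OF xyz(6)] two_p two_q one_each
      by metis
  qed
  show thesis
  proof (rule odd_closed_walk[OF sym' irr' walk _ no])
    fix m g assume "odd m" "5 \<le> m" "hole R' (int m) g"
    then show thesis using that hole_Restr unfolding R'_def by blast
  qed simp
qed

lemma has_bull_Restr: "has_bull (Restr R S) \<Longrightarrow> has_bull R"
  unfolding has_bull_def by blast

text \<open>With \<open>L = 2 * k + 1\<close> and the edge \<open>g 0\<close>, \<open>g 1\<close>,
  the opposite vertex is \<open>g (k + 1)\<close>: it is \<open>k\<close> steps forward from
  \<open>g 1\<close> and \<open>k\<close> steps backward from \<open>g 0\<close>. Restriction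
  creates no holes and no bulls, so the hole stays shortest in the smaller graph.\<close>

lemma apex_witness_if_odd_hole:
  assumes "sym R" "irrefl R" "\<not> has_bull R" "odd m" "5 \<le> m" "hole R (int m) g" "m \<le> N"
  obtains c d where "(c, d) \<in> R" "apex_witness (without_common R c d) N c d"
proof -
  define P where "P m \<longleftrightarrow> odd m \<and> 5 \<le> m \<and> (\<exists>g. hole R (int m) g)" for m
  define L where "L = (LEAST m. P m)"
  have "P m" using assms unfolding P_def by blast
  then have "P L" and "L \<le> m" and least: "P k \<Longrightarrow> L \<le> k" for k
    unfolding L_def by (auto intro: LeastI Least_le)
  then obtain g where L: "odd L" "5 \<le> L" and hole: "hole R (int L) g"
    unfolding P_def by blast
  obtain k where k: "L = 2 * k + 1" using L(1) by (rule oddE)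
  have "2 \<le> k" using L(2) k by simp
  define c d where "c = g 0" and "d = g 1"
  define S where "S = {v. \<not> ((c, v) \<in> R \<and> (d, v) \<in> R)}"
  define R' where "R' = Restr R S"
  have R': "without_common R c d = R'" unfolding without_common_def R'_def S_def ..
  have sym': "sym R'" using assms(1) unfolding R'_def sym_def by auto
  have cd: "(c, d) \<in> R" unfolding c_def d_def hole_adj_iff[OF hole] by simp
  have "g i \<in> S" for i
    unfolding S_def using hole_no_triangle[OF hole, of 0 1 i] L(2) cd symD[OF assms(1)]
    unfolding c_def d_def by auto
  then have hole': "hole R' (int L) g"
    unfolding R'_def by (intro hole_RestrI[OF hole]) auto
  have path: "(g i, g (i + int t)) \<in> R' ^^ t" "(g i, g (i - int t)) \<in> R' ^^ t" for i t
    using hole_path[OF hole', of i t] relpow_sym[OF sym' hole_path[OF hole', of "i - int t" t]] by auto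
  have iso: "\<exists>i' e. \<bar>e\<bar> \<le> int t \<and> g i = g i' \<and> g (i + x) = g (i' + e)"
    if walk: "(g i, g (i + x)) \<in> R' ^^ t" and "t < k" for i x t
  \<comment> \<open>Length 5 is below the range of the locale. As \<open>t < 2\<close> there, it is
    enough that the hole is induced.\<close>
  proof (cases "k = 2")
    case True
    then consider "t = 0" | "t = 1" using \<open>t < k\<close> by linarith
    then show ?thesis
    proof cases
      case 1
      then show ?thesis using walk by (intro exI[of _ i] exI[of _ 0]) simp
    next
      case 2
      then have "(g i, g (i + x)) \<in> R'" using walk by simp
      then have "g (i + x) = g (i + 1) \<or> g (i + x) = g (i + -1)"
        unfolding hole_adj_iff[OF hole'] hole_eq_iff[OF hole'] 
        using dvd_minus_iff[of "int L" "i - (i + x) - 1"] dvd_minus_iff[of "int L" "i - (i + x) + 1"] by (auto simp: algebra_simps)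
      then show ?thesis
      proof
        assume "g (i + x) = g (i + 1)"
        then show ?thesis using 2 by (intro exI[of _ i] exI[of _ 1]) simp
      next
        assume "g (i + x) = g (i + -1)"
        then show ?thesis using 2 by (intro exI[of _ i] exI[of _ "-1"]) simp
      qed
    qed
  next
    case False
    then have "7 \<le> L" using k \<open>2 \<le> k\<close> by simp
    interpret minimal_odd_hole R' L
    proof
      show "irrefl R'" using assms(2) unfolding R'_def irrefl_def by auto
      show "\<not> has_bull R'" using assms(3) has_bull_Restr unfolding R'_def by blast
      show "L \<le> m" if "odd m" "5 \<le> m" "hole R' (int m) g" for m g
        using least that hole_Restr unfolding P_def R'_def by blast
    qed (use sym' L \<open>7 \<le> L\<close> in auto)
    have "\<exists>i. (z, g i) \<notin> R'" for z
    proof (rule ccontr)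
      assume "\<nexists>i. (z, g i) \<notin> R'"
      then have "(z, c) \<in> R'" "(z, d) \<in> R'" unfolding c_def d_def by blast+
      then show False
        using symD[OF assms(1)] unfolding R'_def S_def by blast
    qed
    then have "clean g" using hole' unfolding clean_def by blast
    from isometric[OF this _ _ walk] show ?thesis unfolding near_def by blast
  qed
  \<comment> \<open>The offsets \<open>k\<close> and \<open>k + 1\<close> are the two at the largest
    cyclic distance. A walk with \<open>t < k\<close> would give an offset \<open>e\<close> with
    \<open>\<bar>e\<bar> < k\<close>, congruent to \<open>x\<close> modulo \<open>L\<close>; as
    \<open>\<bar>x - e\<bar> < L\<close>, they would be equal.\<close>
  have lower: "t \<ge> k" if walk: "(g i, g (i + x)) \<in> R' ^^ t" and x: "x = int k \<or> x = int k + 1" for i x t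
  proof (rule ccontr)
    assume "\<not> t \<ge> k"
    then obtain i' e where e: "\<bar>e\<bar> \<le> int t" "g i = g i'" "g (i + x) = g (i' + e)"
      using iso[OF walk] by auto
    then have "int L dvd i + x - (i + e)"
      using hole_shift[OF hole' e(2), of e] hole_eq_iff[OF hole'] by metis
    then have "x = e"
      using dvd_small_iff[of "x - e" "int L"] e(1) x k \<open>\<not> t \<ge> k\<close> by auto
    then show False using e(1) x \<open>\<not> t \<ge> k\<close> by auto
  qed
  define w a b where "w = g (int k + 1)" and "a = g (int k + 2)" and "b = g (int k)"
  \<comment> \<open>Modulo \<open>2 * k + 1\<close>, index \<open>k + 1\<close> is
    \<open>- k\<close>, and \<open>k + 2\<close> is both \<open>- (k - 1)\<close> and
    \<open>1 - k\<close>; these are the arcs running backwards.\<close>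
  have wrap: "w = g (0 - int k)" "a = g (0 - int (k - 1))" "a = g (1 - int k)"
    unfolding w_def a_def hole_eq_iff[OF hole'] k using \<open>2 \<le> k\<close> by (auto simp: of_nat_diff add.commute)
  have aw: "(a, w) \<in> R'" and wb: "(w, b) \<in> R'"
    unfolding w_def a_def b_def hole_adj_iff[OF hole'] by auto
  have ab: "(a, b) \<notin> R'"
    using hole_adj_near_iff[OF hole', of "int k + 2" "int k"] L(2) unfolding a_def b_def by simp
  have cw: "level R' c k w"
    using path(2)[of 0 k] lower[of 0 "int k + 1"] wrap(1) unfolding level_def c_def w_def by (auto simp: not_le[symmetric])
  have dw: "level R' d k w"
    using path(1)[of 1 k] lower[of 1 "int k"] unfolding level_def d_def w_def by (auto simp: not_le[symmetric] add.commute)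
  have da: "level R' d k a"
    using path(2)[of 1 k] lower[of 1 "int k + 1"] wrap(3) unfolding level_def d_def a_def by (auto simp: not_le[symmetric] add.commute)
  have cb: "level R' c k b"
    using path(1)[of 0 k] lower[of 0 "int k"] unfolding level_def c_def b_def by (auto simp: not_le[symmetric])
  have ca: "level R' c (k - 1) a"
    using path(2)[of 0 "k - 1"] wrap(2) level_pred[of R' c "k - 1" w a] cw aw \<open>2 \<le> k\<close> unfolding c_def
    by simp
  have db: "level R' d (k - 1) b"
    using path(1)[of 1 "k - 1"] level_pred[of R' d "k - 1" w b] dw symD[OF sym' wb] \<open>2 \<le> k\<close>
    unfolding d_def b_def by (simp add: of_nat_diff)
  have "apex_witness R' N c d"
    unfolding apex_witness_def
    using cw dw ca da cb db aw wb ab \<open>2 \<le> k\<close> k \<open>L \<le> m\<close> assms(7)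
    by (intro exI[of _ "k - 1"] exI[of _ w] exI[of _ a] exI[of _ b]) auto
  then show thesis using that cd R' by metis
qed

section \<open>Structured programs for the machine\<close>

type_synonym store = "(nat \<Rightarrow> nat) \<times> (nat \<Rightarrow> nat)"

text \<open>A structured language for the machine: registers 0, 1, 2 hold the input size \<open>n\<close>, the
  constant one and the constant zero. \<open>For i c\<close> runs \<open>c\<close> with register \<open>i\<close> counting down from
  \<open>n - 1\<close> to 0; counting down keeps every register within a bound fixed in advance.\<close>
datatype com =
    Basic "instr list"
  | Seq com com (infixr ";;" 60)
  | If nat com
  | For nat com

fun upd :: "instr \<Rightarrow> store \<Rightarrow> store" where
  "upd x (R, M) = (regs (exec_instr x (St 0 R M)), mem (exec_instr x (St 0 R M)))"

fun loop :: "(nat \<Rightarrow> 's \<Rightarrow> 's) \<Rightarrow> nat \<Rightarrow> 's \<Rightarrow> 's" where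
  "loop f 0 s = s"
| "loop f (Suc j) s = loop f j (f j s)"

fun sem :: "com \<Rightarrow> store \<Rightarrow> store" where
  "sem (Basic xs) s = fold upd xs s"
| "sem (c ;; d) s = sem d (sem c s)"
| "sem (If r c) s = (if fst s r = 0 then s else sem c s)"
| "sem (For i c) s =
     loop (\<lambda>j (R, M). sem c (R(i := j), M)) (fst s 0) ((fst s)(i := fst s 0), snd s)"

fun code_size :: "com \<Rightarrow> nat" where
  "code_size (Basic xs) = length xs"
| "code_size (c ;; d) = code_size c + code_size d"
| "code_size (If r c) = 1 + code_size c"
| "code_size (For i c) = 4 + code_size c"

text \<open>The argument \<open>a\<close> is the absolute address of the code, as jumps are
  absolute. \<open>Sub i 0 2\<close> copies register 0, because register 2 holds zero.\<close>

fun code :: "nat \<Rightarrow> com \<Rightarrow> instr list" where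
  "code a (Basic xs) = xs"
| "code a (c ;; d) = code a c @ code (a + code_size c) d"
| "code a (If r c) = Jz r (a + 1 + code_size c) # code (a + 1) c"
| "code a (For i c) =
     [Sub i 0 2, Jz i (a + 4 + code_size c), Sub i i 1] @ code (a + 3) c @ [Jmp (a + 1)]"

fun target :: "instr \<Rightarrow> nat option" where
  "target (Const r c) = Some r"
| "target (Add r a b) = Some r"
| "target (Sub r a b) = Some r"
| "target (Mul r a b) = Some r"
| "target (Div r a b) = Some r"
| "target (Load r a) = Some r"
| "target _ = None"

fun straight :: "instr \<Rightarrow> bool" where
  "straight (Jz r l) = False"
| "straight (Jmp l) = False"
| "straight Halt = False"
| "straight _ = True"

fun writes :: "com \<Rightarrow> nat set" where
  "writes (Basic xs) = {r. \<exists>x\<in>set xs. target x = Some r}"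
| "writes (c ;; d) = writes c \<union> writes d"
| "writes (If r c) = writes c"
| "writes (For i c) = insert i (writes c)"

fun wf_com :: "com \<Rightarrow> bool" where
  "wf_com (Basic xs) \<longleftrightarrow> (\<forall>x\<in>set xs. straight x)"
| "wf_com (c ;; d) \<longleftrightarrow> wf_com c \<and> wf_com d"
| "wf_com (If r c) \<longleftrightarrow> wf_com c"
| "wf_com (For i c) \<longleftrightarrow> wf_com c \<and> i \<notin> writes c"

text \<open>An upper bound: \<open>If\<close> is charged as though always taken. A loop pays for its
  initialization and final test, and in each iteration for test, decrement and jump.\<close>

fun time :: "com \<Rightarrow> nat \<Rightarrow> nat" where
  "time (Basic xs) n = length xs"
| "time (c ;; d) n = time c n + time d n"
| "time (If r c) n = 1 + time c n"
| "time (For i c) n = 2 + n * (3 + time c n)"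

fun depth :: "com \<Rightarrow> nat" where
  "depth (Basic xs) = 0"
| "depth (c ;; d) = max (depth c) (depth d)"
| "depth (If r c) = depth c"
| "depth (For i c) = Suc (depth c)"

text \<open>The constant factor in front of \<open>(n + 1) ^ depth c\<close>. A loop adds 5 because
  its overhead \<open>2 + 3 * n\<close> is at most \<open>5 * (n + 1)\<close>.\<close>

fun weight :: "com \<Rightarrow> nat" where
  "weight (Basic xs) = length xs"
| "weight (c ;; d) = weight c + weight d"
| "weight (If r c) = 1 + weight c"
| "weight (For i c) = 5 + weight c"

section \<open>Running time and correctness of compiled code\<close>

lemma length_code [simp]: "length (code a c) = code_size c"
  by (induction c arbitrary: a) auto

lemma time_le: "time c n \<le> weight c * (n + 1) ^ depth c"
proof (induction c)
  case (Seq c d)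
  have "(n + 1) ^ depth c \<le> (n + 1) ^ max (depth c) (depth d)"
    "(n + 1) ^ depth d \<le> (n + 1) ^ max (depth c) (depth d)"
    by (auto intro!: power_increasing)
  then have "time c n \<le> weight c * (n + 1) ^ max (depth c) (depth d)"
    "time d n \<le> weight d * (n + 1) ^ max (depth c) (depth d)"
    using Seq mult_le_mono2 order_trans by blast+
  then show ?case by (simp add: distrib_right)
next
  case (If r c)
  have "1 \<le> (n + 1) ^ depth c" by simp
  from add_mono[OF this If] show ?case by simp
next
  case (For i c)
  define p where "p = (n + 1) ^ depth c"
  have p: "1 \<le> p" unfolding p_def by simp
  have "n * time c n \<le> n * (weight c * p)"
    using For unfolding p_def by (rule mult_le_mono2)
  moreover have "n * 1 \<le> n * p" using p by (rule mult_le_mono2)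
  moreover have "2 + n * (3 + time c n) = 2 + 3 * n + n * time c n"
    by (simp add: algebra_simps)
  moreover have "(5 + weight c) * ((n + 1) * p) = 5 * p + 5 * (n * p) + weight c * p + n * (weight c * p)"
    by (simp add: algebra_simps)
  ultimately have "2 + n * (3 + time c n) \<le> (5 + weight c) * ((n + 1) * p)"
    using p by linarith
  then show ?case by (simp add: p_def)
qed simp

lemma sem_unwritten: "r \<notin> writes c \<Longrightarrow> fst (sem c s) r = fst s r"
proof (induction c arbitrary: s)
  case (Basic xs)
  have "\<forall>x\<in>set xs. target x \<noteq> Some r \<Longrightarrow> fst (fold upd xs s) r = fst s r"
  proof (induction xs arbitrary: s)
    case (Cons x xs)
    have "fst (upd x s) r = fst s r"
      using Cons.prems by (cases s; cases x) auto
    with Cons show ?case by simp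
  qed simp
  with Basic show ?case by auto
next
  case (For i c)
  have "fst (loop (\<lambda>j (R, M). sem c (R(i := j), M)) m s) r = fst s r" for m s
    by (induction m arbitrary: s) (use For in \<open>auto simp: split_beta\<close>)
  then show ?case using For.prems by simp
qed auto

text \<open>\<open>T\<close> is only an upper bound on the number of steps, since a skipped
  conditional takes fewer.\<close>

definition reach :: "instr list \<Rightarrow> nat \<Rightarrow> nat \<Rightarrow> store \<Rightarrow> nat \<Rightarrow> store \<Rightarrow> bool" where
  "reach P T a s b s' \<longleftrightarrow> (\<exists>t\<le>T. run P t (St a (fst s) (snd s)) = St b (fst s') (snd s'))"

lemma run_add: "run P (t + u) s = run P u (run P t s)"
  unfolding run_def by (subst add.commute) (simp add: funpow_add)

lemma reach_trans:
  assumes "reach P T a s b s'" "reach P U b s' c s''" "T + U \<le> V"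
  shows "reach P V a s c s''"
proof -
  obtain t u where tu: "t \<le> T" "u \<le> U" "run P t (St a (fst s) (snd s)) = St b (fst s') (snd s')"
    "run P u (St b (fst s') (snd s')) = St c (fst s'') (snd s'')"
    using assms(1,2) unfolding reach_def by blast
  then have "run P (t + u) (St a (fst s) (snd s)) = St c (fst s'') (snd s'')"
    by (simp add: run_add)
  with tu(1,2) assms(3) show ?thesis unfolding reach_def by (intro exI[of _ "t + u"]) simp
qed

lemma reach_refl: "reach P T a s a s"
  unfolding reach_def run_def by (intro exI[of _ 0]) simp

lemma reach_step:
  assumes "a < length P" "P ! a = x" "x \<noteq> Halt" "exec_instr x (St a (fst s) (snd s)) = St b (fst s') (snd s')" "1 \<le> T"
  shows "reach P T a s b s'"
  using assms unfolding reach_def run_def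
  by (intro exI[of _ 1]) (simp add: step_def halted_def)

definition code_at :: "instr list \<Rightarrow> nat \<Rightarrow> instr list \<Rightarrow> bool" where
  "code_at P a xs \<longleftrightarrow> (\<exists>ys zs. P = ys @ xs @ zs \<and> length ys = a)"

lemma code_at_append: "code_at P a (xs @ ys) \<longleftrightarrow> code_at P a xs \<and> code_at P (a + length xs) ys"
proof
  assume "code_at P a (xs @ ys)"
  then obtain us vs where P: "P = us @ (xs @ ys) @ vs" "length us = a"
    unfolding code_at_def by blast
  then have "P = us @ xs @ (ys @ vs)" "P = (us @ xs) @ ys @ vs" "length (us @ xs) = a + length xs"
    by simp_all
  then show "code_at P a xs \<and> code_at P (a + length xs) ys"
    using P(2) unfolding code_at_def by blast
next
  assume "code_at P a xs \<and> code_at P (a + length xs) ys"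
  then obtain us vs us' vs' where P: "P = us @ xs @ vs" "length us = a"
    "P = us' @ ys @ vs'" "length us' = a + length xs"
    unfolding code_at_def by blast
  have "take (a + length xs) P = us @ xs" "take (a + length xs) P = us'"
    using P by (metis append.assoc append_eq_conv_conj length_append)+
  then have "P = us @ (xs @ ys) @ vs'" using P(3) by simp
  then show "code_at P a (xs @ ys)" using P(2) unfolding code_at_def by blast
qed

lemma code_at_Cons: "code_at P a (x # xs) \<longleftrightarrow> a < length P \<and> P ! a = x \<and> code_at P (Suc a) xs"
proof -
  have "code_at P a [x] \<longleftrightarrow> a < length P \<and> P ! a = x"
  proof
    assume "a < length P \<and> P ! a = x"
    then have "P = take a P @ [x] @ drop (Suc a) P" "length (take a P) = a"
      using id_take_nth_drop[of a P] by auto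
    then show "code_at P a [x]" unfolding code_at_def by blast
  qed (auto simp: code_at_def nth_append)
  then show ?thesis
    using code_at_append[of P a "[x]" xs] by simp
qed

lemma reach_Basic:
  "code_at P a xs \<Longrightarrow> \<forall>x\<in>set xs. straight x \<Longrightarrow> reach P (length xs) a s (a + length xs) (fold upd xs s)"
proof (induction xs arbitrary: a s)
  case Nil
  then show ?case by (simp add: reach_refl)
next
  case (Cons x xs)
  have "exec_instr x (St a (fst s) (snd s)) = St (Suc a) (fst (upd x s)) (snd (upd x s))"
    using Cons.prems(2) by (cases s; cases x) auto
  moreover have "x \<noteq> Halt" using Cons.prems(2) by auto
  ultimately have "reach P 1 a s (Suc a) (upd x s)"
    using Cons.prems(1) reach_step[of a P x] by (simp add: code_at_Cons)
  moreover have "reach P (length xs) (Suc a) (upd x s) (Suc a + length xs) (fold upd xs (upd x s))"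
    using Cons.IH[of "Suc a" "upd x s"] Cons.prems by (simp add: code_at_Cons)
  ultimately show ?case
    using reach_trans[of P 1 a s "Suc a" "upd x s" "length xs"] by simp
qed

lemma reach_code:
  assumes "wf_com c" "code_at P a (code a c)" "writes c \<inter> {0, 1, 2} = {}"
    "fst s 0 = n" "fst s 1 = 1" "fst s 2 = 0"
  shows "reach P (time c n) a s (a + code_size c) (sem c s)"
  using assms
proof (induction c arbitrary: a s)
  case (Basic xs)
  then show ?case using reach_Basic by simp
next
  case (Seq c d)
  have "reach P (time c n) a s (a + code_size c) (sem c s)"
    using Seq.IH(1)[of a s] Seq.prems by (auto simp: code_at_append)
  moreover have "reach P (time d n) (a + code_size c) (sem c s) (a + code_size c + code_size d) (sem d (sem c s))"
    using Seq.IH(2)[of "a + code_size c" "sem c s"] Seq.prems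
      sem_unwritten[of 0 c s] sem_unwritten[of 1 c s] sem_unwritten[of 2 c s]
    by (auto simp: code_at_append)
  ultimately show ?case
    using reach_trans by (metis add.assoc order_refl sem.simps(2) code_size.simps(2) time.simps(2))
next
  case (If r c)
  have at: "a < length P" "P ! a = Jz r (a + 1 + code_size c)" "code_at P (a + 1) (code (a + 1) c)"
    using If.prems by (simp_all add: code_at_Cons)
  show ?case
  proof (cases "fst s r = 0")
    case True
    then show ?thesis
      using reach_step[OF at(1,2), of s "a + 1 + code_size c" s "1 + time c n"] by simp
  next
    case False
    then have "reach P 1 a s (a + 1) s"
      using reach_step[OF at(1,2), of s "a + 1" s 1] by simp
    moreover have "reach P (time c n) (a + 1) s (a + 1 + code_size c) (sem c s)"
      using If.IH[of "a + 1" s] If.prems at(3) by simp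
    ultimately show ?thesis
      using False reach_trans[of P 1 a s "a + 1" s "time c n"] by simp
  qed
next
  case (For i c)
  let ?e = "a + 4 + code_size c"
  have at: "a < length P" "P ! a = Sub i 0 2" "a + 1 < length P" "P ! (a + 1) = Jz i ?e"
    "a + 2 < length P" "P ! (a + 2) = Sub i i 1" "code_at P (a + 3) (code (a + 3) c)"
    "a + 3 + code_size c < length P" "P ! (a + 3 + code_size c) = Jmp (a + 1)"
    using For.prems by (simp_all add: code_at_Cons code_at_append numeral_eq_Suc)
  define f where "f = (\<lambda>j (R, M). sem c (R(i := j), M))"
  \<comment> \<open>Induction on the counter value, entering at the test behind the initialization,
    which is executed only once.\<close>
  have iter: "reach P (1 + m * (3 + time c n)) (a + 1) s ?e (loop f m s)"
    if "fst s i = m" "fst s 0 = n" "fst s 1 = 1" "fst s 2 = 0" for m s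
    using that
  proof (induction m arbitrary: s)
    case 0
    then show ?case
      using reach_step[OF at(3,4), of s ?e s] by simp
  next
    case (Suc m)
    obtain R M where s: "s = (R, M)" by fastforce
    define s1 where "s1 = (R(i := m), M)"
    define s2 where "s2 = sem c s1"
    have 1: "reach P 1 (a + 1) s (a + 2) s"
      using reach_step[OF at(3,4), of s "a + 2" s 1] Suc.prems by simp
    have 2: "reach P 1 (a + 2) s (a + 3) s1"
      using reach_step[OF at(5,6), of s "a + 3" s1 1] Suc.prems unfolding s1_def s by simp
    have i: "i \<noteq> 0" "i \<noteq> 1" "i \<noteq> 2" using For.prems by auto
    have 3: "reach P (time c n) (a + 3) s1 (a + 3 + code_size c) s2"
      using For.IH[of "a + 3" s1] For.prems at(7) Suc.prems i unfolding s2_def s1_def s by simp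
    have 4: "reach P 1 (a + 3 + code_size c) s2 (a + 1) s2"
      using reach_step[OF at(8,9), of s2 "a + 1" s2 1] by simp
    have "fst s2 r = fst s1 r" if "r \<in> {0, 1, 2, i}" for r
      unfolding s2_def using For.prems that by (intro sem_unwritten) auto
    then have 5: "reach P (1 + m * (3 + time c n)) (a + 1) s2 ?e (loop f m s2)"
      using Suc.IH[of s2] Suc.prems i unfolding s1_def s by simp
    have "loop f (Suc m) s = loop f m s2"
      unfolding s2_def s1_def f_def s by simp
    moreover have "reach P (1 + Suc m * (3 + time c n)) (a + 1) s ?e (loop f m s2)"
      using reach_trans[OF reach_trans[OF reach_trans[OF reach_trans[OF 1 2 order_refl] 3 order_refl] 4 order_refl] 5]
      by simp
    ultimately show ?case by simp
  qed
  define s0 where "s0 = ((fst s)(i := fst s 0), snd s)"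
  have "reach P 1 a s (a + 1) s0"
    using reach_step[OF at(1,2), of s "a + 1" s0 1] For.prems unfolding s0_def by simp
  moreover have "reach P (1 + n * (3 + time c n)) (a + 1) s0 ?e (loop f n s0)"
    using iter[of s0 n] For.prems unfolding s0_def by auto
  ultimately have "reach P (2 + n * (3 + time c n)) a s ?e (loop f n s0)"
    using reach_trans by fastforce
  then show ?case
    using For.prems unfolding s0_def f_def by (simp add: add.assoc)
qed

text \<open>An assignment \<open>\<beta>\<close> of exponents to the registers, together with an exponent \<open>\<mu>\<close> for the
  memory, is a type system: if every instruction is well typed, then no run whatsoever
  exceeds the bounds \<open>(n + 2) ^ \<beta> r\<close> and \<open>(n + 2) ^ \<mu>\<close>.\<close>
fun typed :: "(nat \<Rightarrow> nat) \<Rightarrow> nat \<Rightarrow> instr \<Rightarrow> bool" where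
  "typed \<beta> \<mu> (Const r c) \<longleftrightarrow> c \<le> 2 ^ \<beta> r"
| "typed \<beta> \<mu> (Add r a b) \<longleftrightarrow> \<beta> a < \<beta> r \<and> \<beta> b < \<beta> r"
| "typed \<beta> \<mu> (Sub r a b) \<longleftrightarrow> \<beta> a \<le> \<beta> r"
| "typed \<beta> \<mu> (Mul r a b) \<longleftrightarrow> \<beta> a + \<beta> b \<le> \<beta> r"
| "typed \<beta> \<mu> (Div r a b) \<longleftrightarrow> \<beta> a \<le> \<beta> r"
| "typed \<beta> \<mu> (Load r a) \<longleftrightarrow> \<mu> \<le> \<beta> r"
| "typed \<beta> \<mu> (Store a b) \<longleftrightarrow> \<beta> b \<le> \<mu>"
| "typed \<beta> \<mu> _ \<longleftrightarrow> True"

definition within :: "nat \<Rightarrow> (nat \<Rightarrow> nat) \<Rightarrow> nat \<Rightarrow> state \<Rightarrow> bool" where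
  "within n \<beta> \<mu> s \<longleftrightarrow> (\<forall>r. regs s r \<le> (n + 2) ^ \<beta> r) \<and> (\<forall>a. mem s a \<le> (n + 2) ^ \<mu>)"

lemma within_exec:
  assumes "typed \<beta> \<mu> x" "within n \<beta> \<mu> s"
  shows "within n \<beta> \<mu> (exec_instr x s)"
proof -
  obtain p R M where s: "s = St p R M" by (cases s)
  have R: "R r \<le> (n + 2) ^ \<beta> r" and M: "M a \<le> (n + 2) ^ \<mu>" for r a
    using assms(2) unfolding within_def s by auto
  have mono: "k \<le> (n + 2) ^ j" if "k \<le> (n + 2) ^ i" "i \<le> j" for i j k :: nat
    using that(1) power_increasing[OF that(2), of "n + 2"] by (meson le_add2 one_le_numeral order_trans)
  show ?thesis
  proof (cases x)
    case (Const r c)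
    have "(2 :: nat) ^ \<beta> r \<le> (n + 2) ^ \<beta> r" by (rule power_mono) auto
    then have "c \<le> (n + 2) ^ \<beta> r" using assms(1) unfolding Const by simp
    then show ?thesis using R M unfolding within_def s Const by simp
  next
    case (Add r a b)
    obtain k where k: "\<beta> r = Suc k" "\<beta> a \<le> k" "\<beta> b \<le> k"
      using assms(1) unfolding Add by (cases "\<beta> r") auto
    \<comment> \<open>A sum may double the bound. The strict inequality in the typing rule supplies
      a factor \<open>n + 2 \<ge> 2\<close> to absorb this.\<close>
    have "R a + R b \<le> 2 * (n + 2) ^ k"
      using mono[OF R k(2)] mono[OF R k(3)] by simp
    also have "\<dots> \<le> (n + 2) ^ \<beta> r" unfolding k by simp
    finally show ?thesis using R M unfolding within_def s Add by simp
  next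
    case (Sub r a b)
    have "R a - R b \<le> (n + 2) ^ \<beta> r"
      using mono[OF R, of a "\<beta> r"] assms(1) unfolding Sub by simp
    then show ?thesis using R M unfolding within_def s Sub by simp
  next
    case (Mul r a b)
    have "R a * R b \<le> (n + 2) ^ (\<beta> a + \<beta> b)"
      unfolding power_add by (rule mult_le_mono[OF R R])
    then have "R a * R b \<le> (n + 2) ^ \<beta> r"
      using mono assms(1) unfolding Mul by simp
    then show ?thesis using R M unfolding within_def s Mul by simp
  next
    case (Div r a b)
    have "R a div R b \<le> (n + 2) ^ \<beta> r"
      using le_trans[OF div_le_dividend mono[OF R]] assms(1) unfolding Div by simp
    then show ?thesis using R M unfolding within_def s Div by simp
  next
    case (Load r a)
    have "M (R a) \<le> (n + 2) ^ \<beta> r" using mono[OF M] assms(1) unfolding Load by simp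
    then show ?thesis using R M unfolding within_def s Load by simp
  next
    case (Store a b)
    have "R b \<le> (n + 2) ^ \<mu>" using mono[OF R] assms(1) unfolding Store by simp
    then show ?thesis using R M unfolding within_def s Store by simp
  qed (use assms(2) in \<open>auto simp: within_def s\<close>)
qed

lemma within_run:
  assumes "\<forall>x\<in>set P. typed \<beta> \<mu> x" "within n \<beta> \<mu> s"
  shows "within n \<beta> \<mu> (run P t s)"
proof (induction t)
  case (Suc t)
  have "within n \<beta> \<mu> (step P s')" if "within n \<beta> \<mu> s'" for s'
    using that assms(1) within_exec unfolding step_def halted_def by auto
  with Suc show ?case unfolding run_def by simp
qed (simp add: run_def assms(2))

fun typed_com :: "(nat \<Rightarrow> nat) \<Rightarrow> nat \<Rightarrow> com \<Rightarrow> bool" where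
  "typed_com \<beta> \<mu> (Basic xs) \<longleftrightarrow> (\<forall>x\<in>set xs. typed \<beta> \<mu> x)"
| "typed_com \<beta> \<mu> (c ;; d) \<longleftrightarrow> typed_com \<beta> \<mu> c \<and> typed_com \<beta> \<mu> d"
| "typed_com \<beta> \<mu> (If r c) \<longleftrightarrow> typed_com \<beta> \<mu> c"
| "typed_com \<beta> \<mu> (For i c) \<longleftrightarrow> typed_com \<beta> \<mu> c \<and> \<beta> 0 \<le> \<beta> i"

lemma typed_code: "typed_com \<beta> \<mu> c \<Longrightarrow> x \<in> set (code a c) \<Longrightarrow> typed \<beta> \<mu> x"
  by (induction c arbitrary: a) auto

section \<open>The program\<close>

text \<open>Registers 18 and 19 point to two tables of \<open>n\<close> cells each, placed directly
  behind the adjacency matrix, for the distances from the two ends of the current edge.\<close>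

definition base :: "nat \<Rightarrow> (nat \<Rightarrow> nat) \<Rightarrow> bool" where
  "base n R \<longleftrightarrow> R 0 = n \<and> R 1 = 1 \<and> R 2 = 0 \<and> R 18 = n * n \<and> R 19 = n * n + n"

abbreviation fixed_regs :: "nat set" where
  "fixed_regs \<equiv> {0, 1, 2, 18, 19}"

text \<open>Register use throughout: 3 is the answer flag, 4 the flag of a single visit, 5 to 12 are
  loop variables, and 20 to 30 are scratch.\<close>

definition edge_if :: "bool \<Rightarrow> nat \<Rightarrow> nat \<Rightarrow> com \<Rightarrow> com" where
  "edge_if b i j c = Basic [Mul 20 i 0, Add 21 20 j, Load 24 21, Sub 25 1 24] ;;
     If (if b then 24 else 25) c"

text \<open>The test \<open>M[p + u] = M[q + v] + k\<close> on register contents.\<close>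
definition cell_eq_if :: "nat \<Rightarrow> nat \<Rightarrow> nat \<Rightarrow> nat \<Rightarrow> nat \<Rightarrow> com \<Rightarrow> com" where
  "cell_eq_if p u q v k c = Basic [Add 22 p u, Load 24 22, Add 23 q v, Load 25 23, Add 26 25 k,
     Sub 27 24 26, Sub 28 26 24, Add 29 27 28, Sub 30 1 29] ;; If 30 c"

text \<open>The test \<open>M[p + u] = n - r\<close> on register contents.\<close>
definition cell_is_if :: "nat \<Rightarrow> nat \<Rightarrow> nat \<Rightarrow> com \<Rightarrow> com" where
  "cell_is_if p u r c = Basic [Add 22 p u, Load 24 22, Sub 26 0 r,
     Sub 27 24 26, Sub 28 26 24, Add 29 27 28, Sub 30 1 29] ;; If 30 c"

definition bull_com :: com where
  "bull_com = For 5 (For 6 (For 7 (For 8 (For 9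
     (edge_if True 5 6 (edge_if True 5 7 (edge_if True 6 7 (edge_if True 5 8 (edge_if True 6 9
     (edge_if False 5 9 (edge_if False 6 8 (edge_if False 7 8 (edge_if False 7 9 (edge_if False 8 9
     (Basic [Const 3 1])))))))))))))))"

text \<open>Asks whether the vertex in register 11 belongs to the next layer: it has a neighbour in
  the current one, is unmarked and is no common neighbour. The sum in register 30 is nonzero exactly
  if one of the two adjacencies to the ends of the edge fails.\<close>

definition visit_com :: "nat \<Rightarrow> com" where
  "visit_com p = Basic [Const 4 0] ;;
     For 12 (edge_if True 12 11 (cell_is_if p 12 10 (Basic [Const 4 1]))) ;;
     If 4 (Basic [Add 22 p 11, Load 24 22, Sub 25 1 24,
         Mul 20 5 0, Add 21 20 11, Load 26 21, Mul 20 6 0, Add 21 20 11, Load 27 21,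
         Sub 28 1 26, Sub 29 1 27, Add 30 28 29, Sub 20 0 10, Add 21 20 1] ;;
       If 25 (If 30 (Basic [Store 22 21])))"

text \<open>Breadth-first search from the vertex in register \<open>s\<close>, avoiding the common neighbours of
  the vertices in registers 5 and 6. Cell \<open>p + x\<close> holds one plus the distance of \<open>x\<close>, or 0
  if \<open>x\<close> has not been reached. Since register 10 counts down, \<open>n\<close> minus its content is the mark
  of the layer from which \<open>visit_com\<close> explores.\<close>
definition bfs_com :: "nat \<Rightarrow> nat \<Rightarrow> com" where
  "bfs_com s p = For 11 (Basic [Add 22 p 11, Store 22 2]) ;; Basic [Add 22 p s, Store 22 1] ;;
     For 10 (For 11 (visit_com p))"

text \<open>Registers 7, 8, 9 hold \<open>w\<close>, \<open>a\<close>, \<open>b\<close>. Every cell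
  is compared with that of \<open>w\<close> in the first table, so the distance itself is never
  enumerated.\<close>

definition apex_com :: com where
  "apex_com = For 7 (For 8 (For 9
     (edge_if True 8 7 (edge_if True 7 9 (edge_if False 8 9
     (cell_eq_if 18 7 19 7 2 (cell_eq_if 18 7 19 8 2 (cell_eq_if 18 7 18 9 2
     (cell_eq_if 18 7 18 8 1 (cell_eq_if 18 7 19 9 1 (Basic [Const 3 1])))))))))))"

definition odd_hole_com :: com where
  "odd_hole_com = For 5 (For 6 (edge_if True 5 6 (bfs_com 5 18 ;; bfs_com 6 19 ;; apex_com)))"

definition main_com :: com where
  "main_com = Basic [Mul 18 0 0, Add 19 18 0] ;; bull_com ;; odd_hole_com"

text \<open>Registers from 18 on are numbered along the data flow, each \<open>Add\<close> writing
  to a higher number than it reads, so consecutive exponents make it well typed. Register 30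
  accounts for the maximum 14. The memory exponent 8 is that of register 24, the lowest one that is
  loaded into.\<close>

definition exponent :: "nat \<Rightarrow> nat" where
  "exponent r = (if r < 18 then 1 else min (r - 16) 14)"

lemmas com_defs = edge_if_def cell_eq_if_def cell_is_if_def bull_com_def visit_com_def bfs_com_def
  apex_com_def odd_hole_com_def main_com_def

lemma wf_main_com: "wf_com main_com"
  by (simp add: com_defs)

lemma writes_main_com: "writes main_com \<inter> {0, 1, 2} = {}"
  by (auto simp: com_defs)

lemma depth_main_com: "depth main_com = 5"
  by (simp add: com_defs)

lemma typed_main_com: "typed_com exponent 8 main_com"
  by (simp add: com_defs exponent_def)

text \<open>Specification of a search: \<open>D\<close> are the variables of the enclosing loops, and the flag \<open>f\<close> is only
  ever raised, so that it accumulates the results of the iterations.\<close>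
definition tests ::
  "nat \<Rightarrow> ((nat \<Rightarrow> nat) \<Rightarrow> bool) \<Rightarrow> nat \<Rightarrow> nat set \<Rightarrow> ((nat \<Rightarrow> nat) \<Rightarrow> bool) \<Rightarrow> com \<Rightarrow> bool" where
  "tests n K f D \<phi> c \<longleftrightarrow>
     writes c \<inter> (fixed_regs \<union> D) = {} \<and> f \<notin> fixed_regs \<union> D \<and> f < 20 \<and> D \<subseteq> {..<20} \<and>
     (\<forall>s. base n (fst s) \<and> K (snd s) \<and> (\<forall>r\<in>D. fst s r < n) \<longrightarrow>
        K (snd (sem c s)) \<and> fst (sem c s) f = (if \<phi> (fst s) then 1 else fst s f)) \<and>
     (\<forall>R R'. (\<forall>r\<in>D. R r = R' r) \<longrightarrow> \<phi> R = \<phi> R')"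

lemma base_cong: "(\<And>r. r \<in> fixed_regs \<Longrightarrow> R r = R' r) \<Longrightarrow> base n R = base n R'"
  unfolding base_def by auto

lemma tests_set:
  assumes "f \<notin> fixed_regs \<union> D" "f < 20" "D \<subseteq> {..<20}"
  shows "tests n K f D (\<lambda>_. True) (Basic [Const f 1])"
  using assms unfolding tests_def by (auto simp: disjoint_iff split: prod.splits)

text \<open>As the flag is never lowered, it ends as the disjunction over all iterations. Later
  iterations start from a changed store, but this agrees with the initial one on \<open>D\<close>,
  and \<open>\<phi>\<close> depends only on \<open>D\<close> and the counter.\<close>

lemma tests_For:
  assumes c: "tests n K f (insert i D) \<phi> c" and i: "i \<notin> fixed_regs \<union> D" "i \<noteq> f"
  shows "tests n K f D (\<lambda>R. \<exists>v<n. \<phi> (R(i := v))) (For i c)"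
proof -
  define g where "g = (\<lambda>j (R, M). sem c (R(i := j), M))"
  have w: "writes c \<inter> (fixed_regs \<union> insert i D) = {}"
    using c unfolding tests_def by blast
  have dep: "\<phi> R = \<phi> R'" if "\<forall>r\<in>insert i D. R r = R' r" for R R'
    using c that unfolding tests_def by blast
  have loop: "K (snd (loop g m s)) \<and>
      fst (loop g m s) f = (if \<exists>v<m. \<phi> ((fst s)(i := v)) then 1 else fst s f)"
    if "base n (fst s)" "K (snd s)" "\<forall>r\<in>D. fst s r < n" "m \<le> n" for m s
    using that
  proof (induction m arbitrary: s)
    case (Suc m)
    define s1 where "s1 = ((fst s)(i := m), snd s)"
    define s2 where "s2 = sem c s1"
    have s1: "base n (fst s1)" "K (snd s1)" "\<forall>r\<in>insert i D. fst s1 r < n"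
      using Suc.prems i unfolding s1_def by (auto simp: base_def)
    have s2: "K (snd s2)" "fst s2 f = (if \<phi> (fst s1) then 1 else fst s1 f)"
      using c s1 unfolding tests_def s2_def by blast+
    have frame: "fst s2 r = fst s1 r" if "r \<in> fixed_regs \<union> insert i D" for r
      unfolding s2_def using w that by (intro sem_unwritten) blast
    have b2: "base n (fst s2)"
      using s1(1) frame base_cong[of "fst s2" "fst s1"] by blast
    have d2: "\<forall>r\<in>D. fst s2 r < n"
      using s1(3) frame by auto
    have IH: "K (snd (loop g m s2)) \<and>
        fst (loop g m s2) f = (if \<exists>v<m. \<phi> ((fst s2)(i := v)) then 1 else fst s2 f)"
      by (rule Suc.IH[OF b2 s2(1) d2 Suc_leD[OF Suc.prems(4)]])
    have "\<phi> ((fst s2)(i := v)) = \<phi> ((fst s)(i := v))" for v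
      using frame i unfolding s1_def by (intro dep) auto
    then have "fst (loop g m s2) f = (if \<exists>v<m. \<phi> ((fst s)(i := v)) then 1 else fst s2 f)"
      using IH by (simp only:)
    moreover have "fst s2 f = (if \<phi> ((fst s)(i := m)) then 1 else fst s f)"
      using s2(2) i(2) unfolding s1_def by (simp only: fst_conv fun_upd_other not_sym)
    moreover have "(\<exists>v<Suc m. \<phi> ((fst s)(i := v))) \<longleftrightarrow>
        \<phi> ((fst s)(i := m)) \<or> (\<exists>v<m. \<phi> ((fst s)(i := v)))"
      using less_Suc_eq by metis
    ultimately have "fst (loop g m s2) f = (if \<exists>v<Suc m. \<phi> ((fst s)(i := v)) then 1 else fst s f)"
      by presburger
    moreover have "loop g (Suc m) s = loop g m s2"
      unfolding g_def s2_def s1_def by (simp add: split_beta)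
    ultimately show ?case
      using IH by (simp only:)
  qed simp
  have "K (snd (sem (For i c) s)) \<and>
      fst (sem (For i c) s) f = (if \<exists>v<n. \<phi> ((fst s)(i := v)) then 1 else fst s f)"
    if s: "base n (fst s)" "K (snd s)" "\<forall>r\<in>D. fst s r < n" for s
  proof -
    have "fst s 0 = n" using s(1) unfolding base_def by simp
    moreover have "base n ((fst s)(i := n))" "\<forall>r\<in>D. ((fst s)(i := n)) r < n"
      using s i unfolding base_def by auto
    ultimately show ?thesis
      using loop[of "((fst s)(i := n), snd s)" n] s(2) i(2) unfolding g_def by auto
  qed
  moreover have "(\<exists>v<n. \<phi> (R(i := v))) = (\<exists>v<n. \<phi> (R'(i := v)))" if "\<forall>r\<in>D. R r = R' r" for R R'
    using dep[of "R(i := _)" "R'(i := _)"] that by auto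
  ultimately show ?thesis
    using c w i unfolding tests_def by auto
qed

lemma scratch_memory:
  "\<forall>x\<in>set xs. target x \<noteq> None \<Longrightarrow> snd (fold upd xs s) = snd s"
proof (induction xs arbitrary: s)
  case (Cons x xs)
  have "snd (upd x s) = snd s" using Cons.prems by (cases s; cases x) auto
  with Cons show ?case by simp
qed simp

text \<open>The guard computes in registers from 20 on and stores nothing, whereas
  \<open>tests\<close> keeps the flag and \<open>D\<close> below 20. So evaluating the guard
  disturbs nothing that the guarded search refers to.\<close>

lemma tests_guard:
  assumes c: "tests n K f D \<phi> c" and xs: "\<forall>x\<in>set xs. \<exists>r\<ge>20. target x = Some r"
    and g: "\<And>R M. base n R \<Longrightarrow> K M \<Longrightarrow> \<forall>r\<in>D. R r < n \<Longrightarrow> fst (fold upd xs (R, M)) r \<noteq> 0 \<longleftrightarrow> g R"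
    and dep: "\<And>R R'. \<forall>r\<in>D. R r = R' r \<Longrightarrow> g R = g R'"
  shows "tests n K f D (\<lambda>R. g R \<and> \<phi> R) (Basic xs ;; If r c)"
proof -
  have scratch: "writes (Basic xs) \<subseteq> {20..}" using xs by auto
  have w: "f < 20" "D \<subseteq> {..<20}" "f \<notin> fixed_regs \<union> D" "writes c \<inter> (fixed_regs \<union> D) = {}"
    using c unfolding tests_def by auto
  have "K (snd (sem (Basic xs ;; If r c) s)) \<and>
      fst (sem (Basic xs ;; If r c) s) f = (if g (fst s) \<and> \<phi> (fst s) then 1 else fst s f)"
    if s: "base n (fst s)" "K (snd s)" "\<forall>r\<in>D. fst s r < n" for s
  proof -
    define s1 where "s1 = fold upd xs s"
    have frame: "fst s1 r = fst s r" if "r < 20" for r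
    proof -
      have "r \<notin> writes (Basic xs)" using scratch that by (meson atLeast_iff not_less subsetD)
      from sem_unwritten[OF this, of s] show ?thesis unfolding s1_def by simp
    qed
    have "base n (fst s1) = base n (fst s)"
      by (rule base_cong) (auto intro: frame)
    then have s1: "base n (fst s1)" "\<forall>r\<in>D. fst s1 r < n"
      using s frame w(2) by auto
    have s1_mem: "snd s1 = snd s"
      unfolding s1_def by (rule scratch_memory) (use xs in fastforce)
    have "fst s1 r \<noteq> 0 \<longleftrightarrow> g (fst s)"
      using g[OF s] unfolding s1_def by simp
    moreover have "K (snd (sem c s1)) \<and> fst (sem c s1) f = (if \<phi> (fst s1) then 1 else fst s1 f)"
    proof -
      have "K (snd s1)" using s1_mem s(2) by simp
      then show ?thesis using c s1 unfolding tests_def by blast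
    qed
    moreover have "\<phi> (fst s1) = \<phi> (fst s)"
      using c frame w(2) unfolding tests_def by blast
    ultimately show ?thesis
      using s(2) s1_mem frame[OF w(1)] unfolding s1_def[symmetric] by (auto simp: s1_def[symmetric])
  qed
  moreover have "\<phi> R = \<phi> R'" if "\<forall>r\<in>D. R r = R' r" for R R'
    using c that unfolding tests_def by blast
  moreover have "writes (Basic xs ;; If r c) \<inter> (fixed_regs \<union> D) = {}"
  proof -
    have small: "fixed_regs \<union> D \<subseteq> {..<20}" using w(2) by simp
    have False if "v \<in> writes (Basic xs)" "v \<in> fixed_regs \<union> D" for v
      using subsetD[OF scratch that(1)] subsetD[OF small that(2)] by simp
    then have "writes (Basic xs) \<inter> (fixed_regs \<union> D) = {}" by blast
    moreover have "writes (Basic xs ;; If r c) = writes (Basic xs) \<union> writes c"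
      by (simp only: writes.simps)
    ultimately show ?thesis using w(4) by blast
  qed
  ultimately show ?thesis
    using w dep unfolding tests_def by blast
qed

definition adj_matrix :: "nat \<Rightarrow> (nat \<Rightarrow> nat \<Rightarrow> bool) \<Rightarrow> (nat \<Rightarrow> nat) \<Rightarrow> bool" where
  "adj_matrix n E M \<longleftrightarrow> (\<forall>u<n. \<forall>v<n. M (u * n + v) = (if E u v then 1 else 0))"

lemma tests_edge_if:
  assumes "tests n K f D \<phi> c" "\<And>M. K M \<Longrightarrow> adj_matrix n E M" "i \<in> D" "j \<in> D"
  shows "tests n K f D (\<lambda>R. (E (R i) (R j) = b) \<and> \<phi> R) (edge_if b i j c)"
  unfolding edge_if_def
proof (rule tests_guard[OF assms(1)])
  fix R M assume *: "base n R" "K M" "\<forall>r\<in>D. R r < n"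
  have "D \<subseteq> {..<20}" using assms(1) unfolding tests_def by blast
  then have ij: "i < 20" "j < 20" using assms(3,4) by auto
  have "M (R i * n + R j) = (if E (R i) (R j) then 1 else 0)"
    using assms(2)[OF *(2)] * assms(3,4) unfolding adj_matrix_def by blast
  then show "fst (fold upd [Mul 20 i 0, Add 21 20 j, Load 24 21, Sub 25 1 24] (R, M)) (if b then 24 else 25) \<noteq> 0
      \<longleftrightarrow> E (R i) (R j) = b"
    using *(1) ij unfolding base_def by auto
qed (use assms(3,4) in auto)

text \<open>With truncated subtraction, \<open>(x - y) + (y - x)\<close> vanishes exactly if
  \<open>x = y\<close>, so register 30 ends as the truth value of the equality.\<close>

lemma tests_cell_eq_if:
  assumes "tests n (\<lambda>M. M = M0) f D \<phi> c" "u \<in> D" "v \<in> D" "p \<in> fixed_regs" "q \<in> fixed_regs" "k \<in> fixed_regs"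
    and val: "\<And>R. base n R \<Longrightarrow> R p = P \<and> R q = Q \<and> R k = X"
  shows "tests n (\<lambda>M. M = M0) f D (\<lambda>R. M0 (P + R u) = M0 (Q + R v) + X \<and> \<phi> R) (cell_eq_if p u q v k c)"
  unfolding cell_eq_if_def
proof (rule tests_guard[OF assms(1)])
  fix R M assume *: "base n R" "M = M0" "\<forall>r\<in>D. R r < n"
  have "D \<subseteq> {..<20}" using assms(1) unfolding tests_def by blast
  then have "u < 20" "v < 20" "p < 20" "q < 20" "k < 20" using assms(2-6) by auto
  then show "fst (fold upd [Add 22 p u, Load 24 22, Add 23 q v, Load 25 23, Add 26 25 k,
     Sub 27 24 26, Sub 28 26 24, Add 29 27 28, Sub 30 1 29] (R, M)) 30 \<noteq> 0
      \<longleftrightarrow> M0 (P + R u) = M0 (Q + R v) + X"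
    using *(1,2) val[OF *(1)] unfolding base_def by auto
qed (use assms(2,3) in auto)

lemma tests_cell_is_if:
  assumes "tests n (\<lambda>M. M = M0) f D \<phi> c" "u \<in> D" "r \<in> D" "p \<in> fixed_regs"
    and val: "\<And>R. base n R \<Longrightarrow> R p = P"
  shows "tests n (\<lambda>M. M = M0) f D (\<lambda>R. M0 (P + R u) = n - R r \<and> \<phi> R) (cell_is_if p u r c)"
  unfolding cell_is_if_def
proof (rule tests_guard[OF assms(1)])
  fix R M assume *: "base n R" "M = M0" "\<forall>r\<in>D. R r < n"
  have "D \<subseteq> {..<20}" using assms(1) unfolding tests_def by blast
  then have "u < 20" "r < 20" "p < 20" using assms(2-4) by auto
  then show "fst (fold upd [Add 22 p u, Load 24 22, Sub 26 0 r,
     Sub 27 24 26, Sub 28 26 24, Add 29 27 28, Sub 30 1 29] (R, M)) 30 \<noteq> 0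
      \<longleftrightarrow> M0 (P + R u) = n - R r"
    using *(1,2) val[OF *(1)] unfolding base_def by auto
qed (use assms(2,3) in auto)

section \<open>Correctness of the program\<close>

text \<open>The invariant is indexed by the number of iterations still to come, matching a loop that
  counts down.\<close>

lemma loop_inv:
  assumes "I m s" "\<And>j s. j < m \<Longrightarrow> I (Suc j) s \<Longrightarrow> I j (f j s)"
  shows "I 0 (loop f m s)"
  using assms by (induction m arbitrary: s) auto

lemma sem_For_inv:
  assumes "fst s 0 = n" "I n ((fst s)(i := n), snd s)"
    "\<And>j s. j < n \<Longrightarrow> I (Suc j) s \<Longrightarrow> I j (sem c ((fst s)(i := j), snd s))"
  shows "I 0 (sem (For i c) s)"
  using loop_inv[of I n "((fst s)(i := n), snd s)" "\<lambda>j (R, M). sem c (R(i := j), M)"] assms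
  by (simp add: split_beta)

section \<open>Layers and marks of breadth-first search\<close>

definition edges :: "nat \<Rightarrow> (nat \<Rightarrow> nat \<Rightarrow> bool) \<Rightarrow> (nat \<times> nat) set" where
  "edges n E = {(u, v). u < n \<and> v < n \<and> E u v}"

text \<open>The content of the cell of \<open>x\<close> once the layers up to \<open>k\<close> are explored.\<close>
definition mark :: "('a \<times> 'a) set \<Rightarrow> 'a \<Rightarrow> nat \<Rightarrow> 'a \<Rightarrow> nat" where
  "mark R c k x = (if \<exists>i\<le>k. level R c i x then Suc (THE i. level R c i x) else 0)"

lemma mark_eq_Suc_iff: "mark R c k x = Suc i \<longleftrightarrow> i \<le> k \<and> level R c i x"
proof -
  have "(THE i. level R c i x) = j" if "level R c j x" for j
    using that level_unique by (metis the_equality)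
  then show ?thesis unfolding mark_def by auto
qed

lemma mark_eq_0_iff: "mark R c k x = 0 \<longleftrightarrow> (\<forall>i\<le>k. \<not> level R c i x)"
  unfolding mark_def by auto

text \<open>The recursion behind the search: backwards, a walk of length at most \<open>k\<close> to
  \<open>y\<close> would have a least length, and \<open>y\<close> would already lie in that
  layer.\<close>

lemma level_Suc_iff:
  "level R c (Suc k) y \<longleftrightarrow> (\<forall>i\<le>k. \<not> level R c i y) \<and> (\<exists>x. level R c k x \<and> (x, y) \<in> R)"
proof
  assume *: "level R c (Suc k) y"
  then obtain x where "(c, x) \<in> R ^^ k" "(x, y) \<in> R"
    unfolding level_def by auto
  then show "(\<forall>i\<le>k. \<not> level R c i y) \<and> (\<exists>x. level R c k x \<and> (x, y) \<in> R)"
    using * level_pred level_unique by (metis not_less_eq_eq order_refl)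
next
  assume *: "(\<forall>i\<le>k. \<not> level R c i y) \<and> (\<exists>x. level R c k x \<and> (x, y) \<in> R)"
  have "(c, y) \<notin> R ^^ j" if "j \<le> k" for j
  proof
    assume "(c, y) \<in> R ^^ j"
    define i where "i = (LEAST i. (c, y) \<in> R ^^ i)"
    have "level R c i y" "i \<le> j"
      using \<open>(c, y) \<in> R ^^ j\<close> unfolding level_def i_def
      by (auto intro: LeastI Least_le dest: not_less_Least)
    with * that show False by auto
  qed
  with * show "level R c (Suc k) y"
    unfolding level_def by (auto simp: less_Suc_eq_le)
qed

lemma mark_Suc:
  "mark R c (Suc k) y =
     (if mark R c k y = 0 \<and> (\<exists>x. level R c k x \<and> (x, y) \<in> R) then Suc (Suc k) else mark R c k y)"
proof (cases "mark R c k y")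
  case 0
  then have no: "\<forall>i\<le>k. \<not> level R c i y" by (simp add: mark_eq_0_iff)
  show ?thesis
  proof (cases "\<exists>x. level R c k x \<and> (x, y) \<in> R")
    case True
    then have "mark R c (Suc k) y = Suc (Suc k)"
      using no by (simp add: mark_eq_Suc_iff level_Suc_iff)
    then show ?thesis using 0 True by simp
  next
    case False
    then have "mark R c (Suc k) y = 0"
      using no by (auto simp: mark_eq_0_iff level_Suc_iff le_Suc_eq)
    then show ?thesis using 0 False by simp
  qed
next
  case (Suc i)
  then have "mark R c (Suc k) y = Suc i" by (auto simp: mark_eq_Suc_iff)
  then show ?thesis using Suc by simp
qed

lemma mark_0: "mark R c 0 x = (if x = c then 1 else 0)"
proof (cases "x = c")
  case True
  then have "mark R c 0 x = Suc 0" unfolding mark_eq_Suc_iff level_def by simp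
  with True show ?thesis by simp
qed (simp add: mark_eq_0_iff level_def)

lemma testsD:
  assumes "tests n K f D \<phi> c" "base n R" "K M" "\<forall>r\<in>D. R r < n" "sem c (R, M) = (R', M')"
  shows "K M'" "R' f = (if \<phi> R then 1 else R f)"
proof -
  have "K (snd (sem c (R, M))) \<and> fst (sem c (R, M)) f = (if \<phi> (fst (R, M)) then 1 else fst (R, M) f)"
    using assms(1-4) unfolding tests_def by (metis fst_conv snd_conv)
  then show "K M'" "R' f = (if \<phi> R then 1 else R f)" unfolding assms(5) by simp_all
qed

lemma adj_matrixD: "adj_matrix n E M \<Longrightarrow> u < n \<Longrightarrow> v < n \<Longrightarrow> M (u * n + v) = (if E u v then 1 else 0)"
  unfolding adj_matrix_def by blast

lemma base_unwritten:
  assumes "base n (fst s)" "writes c \<inter> fixed_regs = {}"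
  shows "base n (fst (sem c s))"
proof -
  have "fst (sem c s) r = fst s r" if "r \<in> fixed_regs" for r
    using assms(2) that by (intro sem_unwritten) blast
  then show ?thesis using base_cong[of "fst (sem c s)" "fst s" n] assms(1) by blast
qed

definition block :: "nat \<Rightarrow> nat \<Rightarrow> nat" where
  "block n p = (if p = 18 then n * n else n * n + n)"

lemma base_block: "base n R \<Longrightarrow> p \<in> {18, 19} \<Longrightarrow> R p = block n p"
  unfolding base_def block_def by auto

lemma sem_visit_com:
  assumes s: "base n (fst s)" "adj_matrix n E (snd s)" "p \<in> {18, 19}"
    and lt: "fst s 5 < n" "fst s 6 < n" "fst s 10 < n" "fst s 11 < n"
  shows "snd (sem (visit_com p) s) =
    (let R = fst s; M = snd s; y = R 11; a = block n p + y in
     if M a = 0 \<and> (\<exists>x<n. E x y \<and> M (block n p + x) = n - R 10) \<and> \<not> (E (R 5) y \<and> E (R 6) y)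
     then M(a := Suc (n - R 10)) else M)"
proof -
  obtain R M where RM: "s = (R, M)" by fastforce
  define inner where "inner = For 12 (edge_if True 12 11 (cell_is_if p 12 10 (Basic [Const 4 1])))"
  define R1 where "R1 = R(4 := 0)"
  have b1: "base n R1" using s(1) unfolding RM R1_def base_def by simp
  \<comment> \<open>The scan for a neighbour in the current layer is again a search in the sense of
    \<open>tests\<close>, with flag 4 and with the memory held fixed.\<close>
  have t: "tests n (\<lambda>M'. M' = M) 4 {10, 11}
      (\<lambda>R. \<exists>v<n. (E ((R(12 := v)) 12) ((R(12 := v)) 11) = True) \<and>
         (M (block n p + (R(12 := v)) 12) = n - (R(12 := v)) 10 \<and> True)) inner"
    unfolding inner_def
    by (rule tests_For, rule tests_edge_if, rule tests_cell_is_if, rule tests_set)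
      (use s base_block in \<open>auto simp: RM\<close>)
  obtain R2 M2 where R2: "sem inner (R1, M) = (R2, M2)" by fastforce
  have M2: "M2 = M" and flag: "R2 4 \<noteq> 0 \<longleftrightarrow> (\<exists>x<n. E x (R 11) \<and> M (block n p + x) = n - R 10)"
    using testsD[OF t b1 refl _ R2] lt unfolding RM R1_def by (auto split: if_splits)
  have frame: "R2 r = R r" if "r \<in> {0, 1, 2, 5, 6, 10, 11, 18, 19}" for r
  proof -
    have "r \<notin> writes inner" using that unfolding inner_def by (auto simp: com_defs)
    from sem_unwritten[OF this, of "(R1, M)"] show ?thesis
      using that unfolding R2 by (auto simp: R1_def)
  qed
  have adj: "M (R 5 * n + R 11) = (if E (R 5) (R 11) then 1 else 0)"
    "M (R 6 * n + R 11) = (if E (R 6) (R 11) then 1 else 0)"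
    using adj_matrixD[OF s(2)] lt unfolding RM by simp_all
  have regs: "R2 0 = n" "R2 1 = 1" "R2 5 = R 5" "R2 6 = R 6" "R2 10 = R 10" "R2 11 = R 11" "R2 p = block n p"
  proof -
    have "R 0 = n" "R 1 = 1" "R p = block n p"
      using s(1) base_block[OF s(1) s(3)] unfolding RM base_def by simp_all
    then show "R2 0 = n" "R2 1 = 1" "R2 p = block n p"
      using frame[of 0] frame[of 1] frame[of p] s(3) by auto
  qed (use frame in simp_all)
  have p: "p \<notin> {20, 21, 22, 24, 25, 26, 27, 28, 29, 30}" using s(3) by auto
  define a where "a = block n p + R 11"
  define xs where "xs = [Add 22 p 11, Load 24 22, Sub 25 1 24,
         Mul 20 5 0, Add 21 20 11, Load 26 21, Mul 20 6 0, Add 21 20 11, Load 27 21,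
         Sub 28 1 26, Sub 29 1 27, Add 30 28 29, Sub 20 0 10, Add 21 20 1]"
  obtain R3 M3 where R3: "fold upd xs (R2, M) = (R3, M3)" by fastforce
  have "M3 = M" "R3 22 = a" "R3 25 = 1 - M a" "R3 21 = Suc (n - R 10)"
    "R3 30 = (1 - M (R 5 * n + R 11)) + (1 - M (R 6 * n + R 11))"
    using R3 regs p unfolding xs_def a_def by auto
  then have "M3 = M" "R3 22 = a" "R3 25 \<noteq> 0 \<longleftrightarrow> M a = 0" "R3 21 = Suc (n - R 10)"
    "R3 30 \<noteq> 0 \<longleftrightarrow> \<not> (E (R 5) (R 11) \<and> E (R 6) (R 11))"
    using adj by auto
  moreover have "sem (visit_com p) s =
      sem (If 4 (Basic xs ;; If 25 (If 30 (Basic [Store 22 21])))) (R2, M)"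
  proof -
    have "sem (Basic [Const 4 0]) s = (R1, M)" unfolding RM R1_def by simp
    then show ?thesis
      unfolding visit_com_def inner_def[symmetric] xs_def[symmetric] sem.simps(2)
      using R2 M2 by simp
  qed
  ultimately have "snd (sem (visit_com p) s) =
     (if M a = 0 \<and> (\<exists>x<n. E x (R 11) \<and> M (block n p + x) = n - R 10) \<and> \<not> (E (R 5) (R 11) \<and> E (R 6) (R 11))
      then M(a := Suc (n - R 10)) else M)"
    using flag R3 by (cases "R2 4 = 0"; cases "R3 25 = 0"; cases "R3 30 = 0") auto
  then show ?thesis unfolding RM a_def Let_def fst_conv snd_conv .
qed

section \<open>The search fills the distance tables\<close>

definition overlay :: "nat \<Rightarrow> nat \<Rightarrow> (nat \<Rightarrow> nat) \<Rightarrow> (nat \<Rightarrow> nat) \<Rightarrow> nat \<Rightarrow> nat" where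
  "overlay n B h M a = (if B \<le> a \<and> a < B + n then h (a - B) else M a)"

lemma overlay_at [simp]: "x < n \<Longrightarrow> overlay n B h M (B + x) = h x"
  unfolding overlay_def by simp

lemma overlay_upd: "x < n \<Longrightarrow> (overlay n B h M)(B + x := v) = overlay n B (h(x := v)) M"
  by (rule ext) (auto simp: overlay_def)

lemma overlay_cong: "(\<And>x. x < n \<Longrightarrow> h x = h' x) \<Longrightarrow> overlay n B h M = overlay n B h' M"
  by (rule ext) (auto simp: overlay_def)

lemma adj_matrix_overlay:
  assumes "adj_matrix n E M" "n * n \<le> B"
  shows "adj_matrix n E (overlay n B h M)"
proof -
  have "overlay n B h M (u * n + v) = M (u * n + v)" if "u < n" "v < n" for u v
  proof -
    have "u * n + v < Suc u * n" using that by simp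
    also have "\<dots> \<le> n * n" using that(1) by (intro mult_le_mono1) simp
    finally show ?thesis using assms(2) by (simp add: overlay_def)
  qed
  then show ?thesis
    using assms(1) unfolding adj_matrix_def by simp
qed

abbreviation bfs_graph :: "nat \<Rightarrow> (nat \<Rightarrow> nat \<Rightarrow> bool) \<Rightarrow> nat \<Rightarrow> nat \<Rightarrow> (nat \<times> nat) set" where
  "bfs_graph n E c d \<equiv> without_common (edges n E) c d"

text \<open>\<open>visit_com\<close> checks only the new vertex for being a common neighbour. This
  covers the vertex it is reached from: whatever has a level in the restricted graph has survived
  the deletion.\<close>

lemma level_uncommon:
  assumes "simple_graph n E" "level (bfs_graph n E c d) s k x" "s \<in> {c, d}" "c < n" "d < n"
  shows "x < n \<and> \<not> (E c x \<and> E d x)"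
proof (cases k)
  case 0
  then have "x = s" using assms(2) unfolding level_def by simp
  then show ?thesis using assms unfolding simple_graph_def by auto
next
  case (Suc k')
  then obtain y where "(y, x) \<in> bfs_graph n E c d"
    using assms(2) unfolding level_def by auto
  then show ?thesis using assms(4,5) unfolding without_common_def edges_def by auto
qed

text \<open>In the middle of a sweep the vertices above \<open>y\<close> already carry their updated
  marks, because register 11 counts down.\<close>

lemma sem_visit_mark:
  assumes s: "base n (fst s)" "adj_matrix n E M" "p \<in> {18, 19}" "simple_graph n E"
    and lt: "fst s 5 < n" "fst s 6 < n" "y < n" and r: "n - r = Suc k" "fst s 10 = r"
    and c: "c \<in> {fst s 5, fst s 6}"
    and mem: "snd s = overlay n (block n p)
        (\<lambda>x. if x \<le> y then mark (bfs_graph n E (fst s 5) (fst s 6)) c k x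
             else mark (bfs_graph n E (fst s 5) (fst s 6)) c (Suc k) x) M"
  shows "snd (sem (visit_com p) ((fst s)(11 := y), snd s)) = overlay n (block n p)
        (\<lambda>x. if x < y then mark (bfs_graph n E (fst s 5) (fst s 6)) c k x
             else mark (bfs_graph n E (fst s 5) (fst s 6)) c (Suc k) x) M"
proof -
  define G where "G = bfs_graph n E (fst s 5) (fst s 6)"
  define h where "h x = (if x \<le> y then mark G c k x else mark G c (Suc k) x)" for x
  define R where "R = (fst s)(11 := y)"
  have mem': "snd s = overlay n (block n p) h M" unfolding mem h_def G_def ..
  have "r < n" using r(1) by simp
  have "n * n \<le> block n p" unfolding block_def by simp
  then have adj: "adj_matrix n E (snd s)"
    unfolding mem' by (rule adj_matrix_overlay[OF s(2)])
  have "base n R" using s(1) unfolding R_def base_def by simp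
  then have "snd (sem (visit_com p) (R, snd s)) =
     (if h y = 0 \<and> (\<exists>x<n. E x y \<and> snd s (block n p + x) = Suc k) \<and> \<not> (E (fst s 5) y \<and> E (fst s 6) y)
      then overlay n (block n p) (h(y := Suc (Suc k))) M else overlay n (block n p) h M)"
    using sem_visit_com[of n "(R, snd s)" E p] adj s(3) lt r \<open>r < n\<close> unfolding R_def
    by (simp add: Let_def mem' overlay_upd cong: conj_cong if_cong)
  \<comment> \<open>Cells filled during this sweep hold \<open>Suc (Suc k)\<close>, so they cannot
    be mistaken for members of layer \<open>k\<close>, and updating in place is safe.\<close>
  moreover have "h x = Suc k \<longleftrightarrow> level G c k x" for x
    unfolding h_def by (auto simp: mark_eq_Suc_iff)
  then have "(\<exists>x<n. E x y \<and> snd s (block n p + x) = Suc k) \<longleftrightarrow> (\<exists>x<n. E x y \<and> level G c k x)"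
    unfolding mem' by (metis overlay_at)
  moreover have "(\<exists>x<n. E x y \<and> level G c k x) \<and> \<not> (E (fst s 5) y \<and> E (fst s 6) y) \<longleftrightarrow>
      (\<exists>x. level G c k x \<and> (x, y) \<in> G)"
  proof -
    have "(x, y) \<in> G \<longleftrightarrow> x < n \<and> E x y \<and> \<not> (E (fst s 5) x \<and> E (fst s 6) x) \<and>
        \<not> (E (fst s 5) y \<and> E (fst s 6) y)" for x
      using lt unfolding G_def without_common_def edges_def by auto
    moreover have "x < n \<and> \<not> (E (fst s 5) x \<and> E (fst s 6) x)" if "level G c k x" for x
      using level_uncommon[OF s(4) _ c lt(1,2)] that unfolding G_def by blast
    ultimately show ?thesis by blast
  qed
  ultimately have "snd (sem (visit_com p) (R, snd s)) =
      (if h y = 0 \<and> (\<exists>x. level G c k x \<and> (x, y) \<in> G)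
       then overlay n (block n p) (h(y := Suc (Suc k))) M else overlay n (block n p) h M)"
    by simp
  also have "\<dots> = overlay n (block n p) (\<lambda>x. if x < y then mark G c k x else mark G c (Suc k) x) M"
  proof -
    have "h y = mark G c k y" unfolding h_def by simp
    then show ?thesis
      using mark_Suc[of G c k y]
      by (cases "h y = 0 \<and> (\<exists>x. level G c k x \<and> (x, y) \<in> G)") (force intro!: overlay_cong simp: h_def)+
  qed
  finally show ?thesis unfolding R_def G_def .
qed

lemma sem_bfs_com:
  assumes s: "base n (fst s)" "adj_matrix n E (snd s)" "p \<in> {18, 19}" "simple_graph n E"
    and lt: "fst s 5 < n" "fst s 6 < n" and q: "q \<in> {5, 6}"
  shows "snd (sem (bfs_com q p) s) =
    overlay n (block n p) (mark (bfs_graph n E (fst s 5) (fst s 6)) (fst s q) n) (snd s)"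
proof -
  define B where "B = block n p"
  define M where "M = snd s"
  define c where "c = fst s q"
  define G where "G = bfs_graph n E (fst s 5) (fst s 6)"
  define F :: "nat set" where "F = {0, 1, 2, 5, 6, 18, 19}"
  define keep where "keep s' \<longleftrightarrow> (\<forall>r\<in>F. fst s' r = fst s r)" for s' :: store
  have n: "fst s 0 = n" using s(1) unfolding base_def by simp
  have keep_base: "base n (fst s')" if "keep s'" for s'
    using that s(1) base_cong[of "fst s'" "fst s"] unfolding keep_def F_def by auto
  have keep_upd: "keep (R(r := v), M')" if "keep (R, M'')" "r \<notin> F" for R r v M' M''
    using that unfolding keep_def by auto
  have keep_sem: "keep (sem com s')" if "keep s'" "writes com \<inter> F = {}" for com s'
    unfolding keep_def
  proof
    fix r assume "r \<in> F"
    then have "r \<notin> writes com" using that(2) by blast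
    from sem_unwritten[OF this] show "fst (sem com s') r = fst s r"
      using that(1) \<open>r \<in> F\<close> unfolding keep_def by simp
  qed
  have p: "fst s' p = B" if "keep s'" for s'
    using base_block[OF keep_base[OF that] s(3)] unfolding B_def .
  have p20: "p < 20" "p \<noteq> 11" using s(3) by auto
  have pF: "p \<notin> {4, 10, 11, 12}" using s(3) by auto

  define clear where "clear = For 11 (Basic [Add 22 p 11, Store 22 2])"
  \<comment> \<open>Both tables are reused for every edge, so the cells not yet cleared may hold
    leftovers, here the values of \<open>M\<close>.\<close>
  define I1 where "I1 m s' \<longleftrightarrow> keep s' \<and> snd s' = overlay n B (\<lambda>x. if x < m then M (B + x) else 0) M"
    for m :: nat and s' :: store
  have "I1 0 (sem clear s)"
    unfolding clear_def
  proof (rule sem_For_inv[where n = n])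
    have "overlay n B (\<lambda>x. if x < n then M (B + x) else 0) M = M"
      by (rule ext) (auto simp: overlay_def)
    then show "I1 n ((fst s)(11 := n), snd s)"
      unfolding I1_def keep_def F_def M_def by simp
  next
    fix j s' assume j: "j < n" and I: "I1 (Suc j) s'"
    obtain R M' where s': "s' = (R, M')" by fastforce
    have "R p = B" "R 2 = 0" using I p[of s'] keep_base[of s'] unfolding I1_def s' base_def by auto
    then have eq: "sem (Basic [Add 22 p 11, Store 22 2]) ((fst s')(11 := j), snd s') =
        (R(11 := j, 22 := B + j), M'(B + j := 0))"
      using p20 unfolding s' by simp
    have "M'(B + j := 0) = overlay n B (\<lambda>x. if x < j then M (B + x) else 0) M"
      using I j unfolding I1_def s' by (simp add: overlay_upd) (rule overlay_cong, auto)
    moreover have "keep (R(11 := j, 22 := B + j), M'(B + j := 0))"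
      using I unfolding I1_def s' keep_def F_def by simp
    ultimately show "I1 j (sem (Basic [Add 22 p 11, Store 22 2]) ((fst s')(11 := j), snd s'))"
      unfolding I1_def eq by (simp only: fst_conv snd_conv)
  qed (rule n)
  then have s1: "keep (sem clear s)" "snd (sem clear s) = overlay n B (\<lambda>x. 0) M"
    unfolding I1_def by simp_all

  define s2 where "s2 = sem (Basic [Add 22 p q, Store 22 1]) (sem clear s)"
  have cn: "c < n" using lt q unfolding c_def by auto
  have qF: "q \<in> F" "q \<noteq> 22" using q unfolding F_def by auto
  obtain R1 M1 where R1: "sem clear s = (R1, M1)" by fastforce
  have "R1 p = B" "R1 q = c" "R1 1 = 1"
    using s1(1) p[of "sem clear s"] keep_base[OF s1(1)] qF unfolding R1 keep_def c_def base_def by auto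
  then have s2_eq: "s2 = (R1(22 := B + c), M1(B + c := 1))"
    unfolding s2_def R1 by simp
  have "M1(B + c := 1) = overlay n B ((\<lambda>x. 0)(c := 1)) M"
    using s1(2) cn unfolding R1 by (simp add: overlay_upd)
  also have "\<dots> = overlay n B (mark G c 0) M"
    by (rule overlay_cong) (simp add: mark_0)
  finally have s2: "keep s2" "snd s2 = overlay n B (mark G c 0) M"
    using s1(1) unfolding s2_eq R1 by (simp_all add: keep_def F_def)

  \<comment> \<open>With \<open>m\<close> outer iterations to come, the layers up to
    \<open>n - m\<close> are explored; for \<open>m = n\<close> only the source is marked.\<close>
  define I2 where "I2 m s' \<longleftrightarrow> keep s' \<and> snd s' = overlay n B (mark G c (n - m)) M"
    for m :: nat and s' :: store
  have "I2 0 (sem (For 10 (For 11 (visit_com p))) s2)"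
  proof (rule sem_For_inv[where n = n])
    show "fst s2 0 = n" using keep_base[OF s2(1)] unfolding base_def by simp
    show "I2 n ((fst s2)(10 := n), snd s2)"
      using s2 unfolding I2_def keep_def F_def by simp
  next
    fix r s' assume r: "r < n" and I: "I2 (Suc r) s'"
    define k where "k = n - Suc r"
    have k: "n - r = Suc k" using r unfolding k_def by simp
    define s3 where "s3 = ((fst s')(10 := r), snd s')"
    have s3: "keep s3" "fst s3 10 = r" "snd s3 = overlay n B (mark G c k) M"
      using I unfolding I2_def s3_def keep_def F_def k_def by simp_all
    define J where "J m s' \<longleftrightarrow> keep s' \<and> fst s' 10 = r \<and>
        snd s' = overlay n B (\<lambda>x. if x < m then mark G c k x else mark G c (Suc k) x) M"
      for m :: nat and s' :: store
    have "J 0 (sem (For 11 (visit_com p)) s3)"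
    proof (rule sem_For_inv[where n = n])
      show "fst s3 0 = n" using keep_base[OF s3(1)] unfolding base_def by simp
      have "keep ((fst s3)(11 := n), snd s3)"
        using s3(1) unfolding keep_def F_def by simp
      moreover have "snd s3 = overlay n B (\<lambda>x. if x < n then mark G c k x else mark G c (Suc k) x) M"
        unfolding s3(3) by (rule overlay_cong) simp
      ultimately show "J n ((fst s3)(11 := n), snd s3)"
        using s3(2) unfolding J_def by simp
    next
      fix y s' assume y: "y < n" and J: "J (Suc y) s'"
      have k': "keep s'" "fst s' 10 = r" using J unfolding J_def by auto
      have mem: "snd s' = overlay n B (\<lambda>x. if x \<le> y then mark G c k x else mark G c (Suc k) x) M"
        using J unfolding J_def less_Suc_eq_le by blast
      have R56: "fst s' 5 = fst s 5" "fst s' 6 = fst s 6" using k'(1) unfolding keep_def F_def by auto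
      have "snd (sem (visit_com p) ((fst s')(11 := y), snd s')) =
          overlay n B (\<lambda>x. if x < y then mark G c k x else mark G c (Suc k) x) M"
        unfolding B_def G_def R56[symmetric]
      proof (rule sem_visit_mark)
        show "base n (fst s')" using keep_base[OF k'(1)] .
        show "adj_matrix n E M" using s(2) unfolding M_def .
        show "c \<in> {fst s' 5, fst s' 6}" using q unfolding c_def R56 by auto
        show "snd s' = overlay n (block n p)
          (\<lambda>x. if x \<le> y then mark (bfs_graph n E (fst s' 5) (fst s' 6)) c k x
             else mark (bfs_graph n E (fst s' 5) (fst s' 6)) c (Suc k) x) M"
          using mem unfolding R56 G_def B_def .
      qed (use s lt y k k'(2) R56 in auto)
      moreover have "keep (sem (visit_com p) ((fst s')(11 := y), snd s'))"
      proof (rule keep_sem)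
        show "keep ((fst s')(11 := y), snd s')" using k'(1) unfolding keep_def F_def by simp
        show "writes (visit_com p) \<inter> F = {}" unfolding F_def by (auto simp: com_defs)
      qed
      moreover have "10 \<notin> writes (visit_com p)" by (auto simp: com_defs)
      then have "fst (sem (visit_com p) ((fst s')(11 := y), snd s')) 10 = r"
        using sem_unwritten k'(2) by simp
      ultimately show "J y (sem (visit_com p) ((fst s')(11 := y), snd s'))"
        unfolding J_def by blast
    qed
    moreover have "n - r = Suc k" using k .
    ultimately show "I2 r (sem (For 11 (visit_com p)) ((fst s')(10 := r), snd s'))"
      unfolding I2_def J_def s3_def by simp
  qed
  then show ?thesis
    unfolding I2_def s2_def clear_def bfs_com_def B_def G_def c_def M_def by simp
qed

section \<open>Searching for an apex or a bull\<close>

definition apex_cond :: "nat \<Rightarrow> (nat \<Rightarrow> nat \<Rightarrow> bool) \<Rightarrow> nat \<Rightarrow> nat \<Rightarrow> bool" where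
  "apex_cond n E c d \<longleftrightarrow>
     (let f = mark (bfs_graph n E c d) c n; h = mark (bfs_graph n E c d) d n in
      \<exists>w<n. \<exists>a<n. \<exists>b<n. E a w \<and> E w b \<and> \<not> E a b \<and>
        f w = h w \<and> f w = h a \<and> f w = f b \<and> f w = Suc (f a) \<and> f w = Suc (h b))"

lemma tests_apex_com:
  assumes "adj_matrix n E M"
  shows "tests n (\<lambda>M'. M' = M) 3 {5, 6}
    (\<lambda>R. \<exists>w<n. \<exists>a<n. \<exists>b<n. E a w \<and> E w b \<and> \<not> E a b \<and>
       M (n * n + w) = M (n * n + n + w) \<and> M (n * n + w) = M (n * n + n + a) \<and>
       M (n * n + w) = M (n * n + b) \<and> M (n * n + w) = Suc (M (n * n + a)) \<and>
       M (n * n + w) = Suc (M (n * n + n + b))) apex_com"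
proof -
  let ?B = "\<lambda>p. if p = 18 then n * n else n * n + n"
  have cell: "base n R \<Longrightarrow> R 18 = n * n \<and> R q = ?B q \<and> R k = (if k = 1 then 1 else 0)"
    if "q \<in> {18, 19}" "k \<in> {1, 2}" for R q k
    using that unfolding base_def by auto
  have "tests n (\<lambda>M'. M' = M) 3 {5, 6}
    (\<lambda>R. \<exists>w<n. \<exists>a<n. \<exists>b<n.
       (E ((R(7 := w, 8 := a, 9 := b)) 8) ((R(7 := w, 8 := a, 9 := b)) 7) = True) \<and>
       (E ((R(7 := w, 8 := a, 9 := b)) 7) ((R(7 := w, 8 := a, 9 := b)) 9) = True) \<and>
       (E ((R(7 := w, 8 := a, 9 := b)) 8) ((R(7 := w, 8 := a, 9 := b)) 9) = False) \<and>
       M (n * n + (R(7 := w, 8 := a, 9 := b)) 7) = M (n * n + n + (R(7 := w, 8 := a, 9 := b)) 7) + 0 \<and>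
       M (n * n + (R(7 := w, 8 := a, 9 := b)) 7) = M (n * n + n + (R(7 := w, 8 := a, 9 := b)) 8) + 0 \<and>
       M (n * n + (R(7 := w, 8 := a, 9 := b)) 7) = M (n * n + (R(7 := w, 8 := a, 9 := b)) 9) + 0 \<and>
       M (n * n + (R(7 := w, 8 := a, 9 := b)) 7) = M (n * n + (R(7 := w, 8 := a, 9 := b)) 8) + 1 \<and>
       M (n * n + (R(7 := w, 8 := a, 9 := b)) 7) = M (n * n + n + (R(7 := w, 8 := a, 9 := b)) 9) + 1 \<and>
       True) apex_com"
    unfolding apex_com_def
    by (intro tests_For tests_edge_if tests_cell_eq_if tests_set)
      (use assms in \<open>auto simp: base_def\<close>)
  then show ?thesis by simp
qed

text \<open>The enclosing loops rely only on the adjacency matrix in memory, and the tables lie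
  behind it, so they may be overwritten for each edge. For the apex search the whole memory is then
  fixed.\<close>

lemma tests_search_com:
  assumes "simple_graph n E"
  shows "tests n (adj_matrix n E) 3 {5, 6} (\<lambda>R. apex_cond n E (R 5) (R 6))
    (bfs_com 5 18 ;; bfs_com 6 19 ;; apex_com)"
proof -
  have main: "adj_matrix n E (snd (sem (bfs_com 5 18 ;; bfs_com 6 19 ;; apex_com) s)) \<and>
      fst (sem (bfs_com 5 18 ;; bfs_com 6 19 ;; apex_com) s) 3 =
        (if apex_cond n E (fst s 5) (fst s 6) then 1 else fst s 3)"
    if s: "base n (fst s)" "adj_matrix n E (snd s)" "\<forall>r\<in>{5, 6}. fst s r < n" for s
  proof -
    define G where "G = bfs_graph n E (fst s 5) (fst s 6)"
    define s1 where "s1 = sem (bfs_com 5 18) s"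
    define s2 where "s2 = sem (bfs_com 6 19) s1"
    have w: "writes (bfs_com q p) \<inter> {0, 1, 2, 3, 5, 6, 18, 19} = {}" for q p
      by (auto simp: com_defs)
    have keep1: "fst s1 r = fst s r" and keep2: "fst s2 r = fst s r"
      if "r \<in> {0, 1, 2, 3, 5, 6, 18, 19}" for r
    proof -
      have "r \<notin> writes (bfs_com q p)" for q p using w[of q p] that by blast
      then show "fst s1 r = fst s r" "fst s2 r = fst s r"
        unfolding s2_def s1_def by (simp_all add: sem_unwritten)
    qed
    have base: "base n (fst s1)" "base n (fst s2)"
      using base_cong[of "fst s1" "fst s" n] base_cong[of "fst s2" "fst s" n] keep1 keep2 s(1) by auto
    have s1: "snd s1 = overlay n (n * n) (mark G (fst s 5) n) (snd s)"
      using sem_bfs_com[OF s(1,2) _ assms, of 18 5] s(3) unfolding s1_def G_def block_def by simp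
    then have adj1: "adj_matrix n E (snd s1)"
      by (simp add: adj_matrix_overlay[OF s(2)])
    have s2: "snd s2 = overlay n (n * n + n) (mark G (fst s 6) n) (snd s1)"
      using sem_bfs_com[OF base(1) adj1 _ assms, of 19 6] s(3) keep1[of 5] keep1[of 6]
      unfolding s2_def G_def block_def by simp
    then have adj2: "adj_matrix n E (snd s2)"
      by (simp add: adj_matrix_overlay[OF adj1])
    have m1: "snd s2 (n * n + x) = mark G (fst s 5) n x" if "x < n" for x
      using that unfolding s2 s1 by (simp add: overlay_def)
    have m2: "snd s2 (n * n + n + x) = mark G (fst s 6) n x" if "x < n" for x
      using that unfolding s2 by simp
    obtain R2 M2 where s2_eq: "s2 = (R2, M2)" by fastforce
    obtain R3 M3 where s3: "sem apex_com (R2, M2) = (R3, M3)" by fastforce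
    have reg: "\<forall>r\<in>{5, 6}. R2 r < n" using keep2 s(3) unfolding s2_eq by auto
    note t = testsD[OF tests_apex_com[OF adj2[unfolded s2_eq snd_conv]] base(2)[unfolded s2_eq fst_conv] refl reg s3]
    have "(\<exists>w<n. \<exists>a<n. \<exists>b<n. E a w \<and> E w b \<and> \<not> E a b \<and>
       M2 (n * n + w) = M2 (n * n + n + w) \<and> M2 (n * n + w) = M2 (n * n + n + a) \<and>
       M2 (n * n + w) = M2 (n * n + b) \<and> M2 (n * n + w) = Suc (M2 (n * n + a)) \<and>
       M2 (n * n + w) = Suc (M2 (n * n + n + b))) \<longleftrightarrow> apex_cond n E (fst s 5) (fst s 6)"
      using m1 m2 unfolding apex_cond_def s2_eq snd_conv G_def[symmetric] Let_def
      by (simp cong: conj_cong)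
    then have "M3 = M2 \<and> R3 3 = (if apex_cond n E (fst s 5) (fst s 6) then 1 else R2 3)"
      using t by (simp only:)
    moreover have "R2 3 = fst s 3" using keep2[of 3] unfolding s2_eq by simp
    moreover have "sem (bfs_com 5 18 ;; bfs_com 6 19 ;; apex_com) s = (R3, M3)"
      using s3 s2_eq unfolding s2_def s1_def by simp
    ultimately show ?thesis using adj2 unfolding s2_eq by simp
  qed
  have "writes (bfs_com 5 18 ;; bfs_com 6 19 ;; apex_com) \<inter> (fixed_regs \<union> {5, 6}) = {}"
    by (auto simp: com_defs)
  then show ?thesis
    unfolding tests_def using main by auto
qed

lemma tests_odd_hole_com:
  assumes "simple_graph n E"
  shows "tests n (adj_matrix n E) 3 {} (\<lambda>_. \<exists>c<n. \<exists>d<n. E c d \<and> apex_cond n E c d) odd_hole_com"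
proof -
  have "tests n (adj_matrix n E) 3 {}
    (\<lambda>R. \<exists>c<n. \<exists>d<n. (E ((R(5 := c, 6 := d)) 5) ((R(5 := c, 6 := d)) 6) = True) \<and>
      apex_cond n E ((R(5 := c, 6 := d)) 5) ((R(5 := c, 6 := d)) 6)) odd_hole_com"
    unfolding odd_hole_com_def
    by (intro tests_For tests_edge_if) (use tests_search_com[OF assms] in \<open>auto simp: insert_commute\<close>)
  then show ?thesis by simp
qed

definition bull_cond :: "nat \<Rightarrow> (nat \<Rightarrow> nat \<Rightarrow> bool) \<Rightarrow> bool" where
  "bull_cond n E \<longleftrightarrow> (\<exists>x<n. \<exists>y<n. \<exists>z<n. \<exists>p<n. \<exists>q<n.
     E x y \<and> E x z \<and> E y z \<and> E x p \<and> E y q \<and> \<not> E x q \<and> \<not> E y p \<and> \<not> E z p \<and> \<not> E z q \<and> \<not> E p q)"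

lemma tests_bull_com: "tests n (adj_matrix n E) 3 {} (\<lambda>_. bull_cond n E) bull_com"
proof -
  have "tests n (adj_matrix n E) 3 {}
    (\<lambda>R. \<exists>x<n. \<exists>y<n. \<exists>z<n. \<exists>p<n. \<exists>q<n.
      (E ((R(5 := x, 6 := y, 7 := z, 8 := p, 9 := q)) 5) ((R(5 := x, 6 := y, 7 := z, 8 := p, 9 := q)) 6) = True) \<and>
      (E ((R(5 := x, 6 := y, 7 := z, 8 := p, 9 := q)) 5) ((R(5 := x, 6 := y, 7 := z, 8 := p, 9 := q)) 7) = True) \<and>
      (E ((R(5 := x, 6 := y, 7 := z, 8 := p, 9 := q)) 6) ((R(5 := x, 6 := y, 7 := z, 8 := p, 9 := q)) 7) = True) \<and>
      (E ((R(5 := x, 6 := y, 7 := z, 8 := p, 9 := q)) 5) ((R(5 := x, 6 := y, 7 := z, 8 := p, 9 := q)) 8) = True) \<and>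
      (E ((R(5 := x, 6 := y, 7 := z, 8 := p, 9 := q)) 6) ((R(5 := x, 6 := y, 7 := z, 8 := p, 9 := q)) 9) = True) \<and>
      (E ((R(5 := x, 6 := y, 7 := z, 8 := p, 9 := q)) 5) ((R(5 := x, 6 := y, 7 := z, 8 := p, 9 := q)) 9) = False) \<and>
      (E ((R(5 := x, 6 := y, 7 := z, 8 := p, 9 := q)) 6) ((R(5 := x, 6 := y, 7 := z, 8 := p, 9 := q)) 8) = False) \<and>
      (E ((R(5 := x, 6 := y, 7 := z, 8 := p, 9 := q)) 7) ((R(5 := x, 6 := y, 7 := z, 8 := p, 9 := q)) 8) = False) \<and>
      (E ((R(5 := x, 6 := y, 7 := z, 8 := p, 9 := q)) 7) ((R(5 := x, 6 := y, 7 := z, 8 := p, 9 := q)) 9) = False) \<and>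
      (E ((R(5 := x, 6 := y, 7 := z, 8 := p, 9 := q)) 8) ((R(5 := x, 6 := y, 7 := z, 8 := p, 9 := q)) 9) = False) \<and>
      True) bull_com"
    unfolding bull_com_def
    by (intro tests_For tests_edge_if tests_set) auto
  then show ?thesis unfolding bull_cond_def by simp
qed

section \<open>From the graph notions to the conditions tested\<close>

lemma simple_graphD:
  "simple_graph n E \<Longrightarrow> u < n \<Longrightarrow> v < n \<Longrightarrow> E u v \<longleftrightarrow> E v u"
  "simple_graph n E \<Longrightarrow> u < n \<Longrightarrow> \<not> E u u"
  unfolding simple_graph_def by blast+

lemma contains_bull_iff:
  assumes "simple_graph n E"
  shows "contains_bull n E \<longleftrightarrow> bull_cond n E"
proof
  assume "contains_bull n E"
  then obtain f where f: "f ` {..<5} \<subseteq> {..<n}" "\<forall>u<5. \<forall>v<5. bull_adj u v \<longleftrightarrow> E (f u) (f v)"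
    unfolding contains_bull_def contains_def by blast
  have lt: "f i < n" if "i < 5" for i using f(1) that by auto
  have adj: "E (f u) (f v) \<longleftrightarrow> bull_adj u v" if "u < 5" "v < 5" for u v using f(2) that by blast
  show "bull_cond n E"
    unfolding bull_cond_def
    by (intro exI[of _ "f 0"] exI[of _ "f 1"] exI[of _ "f 2"] exI[of _ "f 3"] exI[of _ "f 4"] conjI)
      (simp_all add: lt adj bull_adj_def doubleton_eq_iff)
next
  assume "bull_cond n E"
  then obtain x y z p q where v: "x < n" "y < n" "z < n" "p < n" "q < n"
    and e: "E x y" "E x z" "E y z" "E x p" "E y q" "\<not> E x q" "\<not> E y p" "\<not> E z p" "\<not> E z q" "\<not> E p q"
    unfolding bull_cond_def by blast
  note sym = simple_graphD(1)[OF assms] and irr = simple_graphD(2)[OF assms]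
  define f :: "nat \<Rightarrow> nat" where "f = (\<lambda>i. [x, y, z, p, q] ! i)"
  have five: "(\<forall>u<5. P u) \<longleftrightarrow> P 0 \<and> P 1 \<and> P 2 \<and> P 3 \<and> P (4 :: nat)" for P
    by (auto simp: numeral_eq_Suc less_Suc_eq)
  have adj: "\<forall>u<5. \<forall>v<5. bull_adj u v \<longleftrightarrow> E (f u) (f v)"
    unfolding five f_def
    using e irr[OF v(1)] irr[OF v(2)] irr[OF v(3)] irr[OF v(4)] irr[OF v(5)]
      sym[OF v(1,2)] sym[OF v(1,3)] sym[OF v(1,4)] sym[OF v(1,5)] sym[OF v(2,3)] sym[OF v(2,4)]
      sym[OF v(2,5)] sym[OF v(3,4)] sym[OF v(3,5)] sym[OF v(4,5)]
    by (simp add: bull_adj_def doubleton_eq_iff)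
  moreover have "inj_on f {..<5}"
  proof (rule inj_onI)
    fix u v :: nat assume uv: "u \<in> {..<5}" "v \<in> {..<5}" "f u = f v"
    \<comment> \<open>Equal images have equal adjacencies, and no two vertices of the bull have the
      same neighbourhood.\<close>
    then have "\<forall>w<5. bull_adj u w = bull_adj v w" using adj by simp
    moreover have "\<forall>u<5. \<forall>v<5. (\<forall>w<5. bull_adj u w = bull_adj v w) \<longrightarrow> u = v"
      unfolding five by (simp add: bull_adj_def doubleton_eq_iff)
    ultimately show "u = v" using uv by simp
  qed
  moreover have "\<forall>u<5. f u < n" unfolding five f_def using v by simp
  then have "f ` {..<5} \<subseteq> {..<n}" by auto
  ultimately show "contains_bull n E"
    unfolding contains_bull_def contains_def by blast
qed

lemma bull_cond_iff: "simple_graph n E \<Longrightarrow> bull_cond n E \<longleftrightarrow> has_bull (edges n E)"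
  unfolding bull_cond_def has_bull_def edges_def by auto blast+

lemma sym_edges: "simple_graph n E \<Longrightarrow> sym (edges n E)"
  unfolding sym_def edges_def simple_graph_def by blast

lemma irrefl_edges: "simple_graph n E \<Longrightarrow> irrefl (edges n E)"
  unfolding irrefl_def edges_def simple_graph_def by blast

text \<open>The bound \<open>m \<le> n\<close>, which injectivity provides, is what makes
  \<open>n\<close> layers of search suffice.\<close>

lemma contains_odd_hole_iff:
  "contains_odd_hole n E \<longleftrightarrow> (\<exists>m g. odd m \<and> 5 \<le> m \<and> m \<le> n \<and> hole (edges n E) (int m) g)"
proof
  assume "contains_odd_hole n E"
  then obtain k f where k: "4 \<le> k" "odd k" and f: "inj_on f {..<k}" "f ` {..<k} \<subseteq> {..<n}"
    "\<forall>u<k. \<forall>v<k. cycle_adj k u v \<longleftrightarrow> E (f u) (f v)"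
    unfolding contains_odd_hole_def contains_def by blast
  have "f u < n" if "u < k" for u using f(2) that by auto
  then have "nat_hole (edges n E) k f"
    unfolding nat_hole_def edges_def using f(1,3) by auto
  moreover have "k \<le> n" using card_inj_on_le[OF f(1,2)] by simp
  moreover have "5 \<le> k" using k by presburger
  ultimately show "\<exists>m g. odd m \<and> 5 \<le> m \<and> m \<le> n \<and> hole (edges n E) (int m) g"
    using k(2) hole_of_nat_hole[of "edges n E" k f] by force
next
  assume "\<exists>m g. odd m \<and> 5 \<le> m \<and> m \<le> n \<and> hole (edges n E) (int m) g"
  then obtain m g where m: "odd m" "5 \<le> m" and g: "hole (edges n E) (int m) g" by blast
  define f where "f u = g (int u)" for u
  have f: "nat_hole (edges n E) m f" unfolding f_def by (rule nat_hole_of_hole[OF g])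
  have lt: "f u < n" for u
  proof -
    have "(g (int u), g (int u + 1)) \<in> edges n E" using hole_adj_iff[OF g] by simp
    then show ?thesis unfolding f_def edges_def by simp
  qed
  have "contains n E m (cycle_adj m)"
    unfolding contains_def using f lt unfolding nat_hole_def edges_def by (intro exI[of _ f]) auto
  with m show "contains_odd_hole n E" unfolding contains_odd_hole_def by (intro exI[of _ m]) auto
qed

text \<open>Marks are distances plus one, except that 0 means unreached. The equations on marks
  exclude 0 for all but \<open>a\<close> and \<open>b\<close>; were it the mark of \<open>a\<close>,
  then \<open>w\<close> would have mark 1 in both tables and equal both \<open>c\<close> and
  \<open>d\<close>. On reached vertices, adjacency in the restricted graph agrees with
  \<open>E\<close>.\<close>

lemma apex_cond_iff:
  assumes "simple_graph n E" "c < n" "d < n" "E c d"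
  shows "apex_cond n E c d \<longleftrightarrow> apex_witness (bfs_graph n E c d) n c d"
proof -
  define G where "G = bfs_graph n E c d"
  define f where "f = mark G c n"
  define h where "h = mark G d n"
  note unc = level_uncommon[OF assms(1) _ _ assms(2,3), folded G_def]
  have G_iff: "(x, y) \<in> G \<longleftrightarrow> x < n \<and> y < n \<and> E x y \<and> \<not> (E c x \<and> E d x) \<and> \<not> (E c y \<and> E d y)" for x y
    using assms(2,3) unfolding G_def without_common_def edges_def by auto
  have cond: "apex_cond n E c d \<longleftrightarrow> (\<exists>w<n. \<exists>a<n. \<exists>b<n. E a w \<and> E w b \<and> \<not> E a b \<and>
        f w = h w \<and> f w = h a \<and> f w = f b \<and> f w = Suc (f a) \<and> f w = Suc (h b))"
    unfolding apex_cond_def Let_def f_def h_def G_def ..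
  have f: "f x = Suc i \<longleftrightarrow> i \<le> n \<and> level G c i x" and h: "h x = Suc i \<longleftrightarrow> i \<le> n \<and> level G d i x" for x i
    unfolding f_def h_def by (rule mark_eq_Suc_iff)+
  show ?thesis
    unfolding G_def[symmetric]
  proof
    assume "apex_cond n E c d"
    then obtain w a b where lt: "w < n" "a < n" "b < n" and e: "E a w" "E w b" "\<not> E a b"
      and m: "h w = f w" "h a = f w" "f b = f w" "f w = Suc (f a)" "f w = Suc (h b)"
      unfolding cond by metis
    have "f a \<noteq> 0"
    proof
      assume "f a = 0"
      then have "level G c 0 w" "level G d 0 w" using f[of w 0] h[of w 0] m by simp_all
      then have "c = d" unfolding level_def by simp
      then show False using assms simple_graphD(2) by blast
    qed
    then obtain j where j: "f a = Suc j" by (cases "f a") auto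
    then have hb: "h b = Suc j" using m by simp
    have lv: "level G c (Suc j) w" "level G d (Suc j) w" "level G c j a" "level G d (Suc j) a"
      "level G c (Suc j) b" "level G d j b" "Suc j \<le> n"
      using f[of w "Suc j"] h[of w "Suc j"] f[of a j] h[of a "Suc j"] f[of b "Suc j"] h[of b j] m j hb
      by auto
    have "(a, w) \<in> G" "(w, b) \<in> G" "(a, b) \<notin> G"
      unfolding G_iff using lt e unc[OF lv(1)] unc[OF lv(3)] unc[OF lv(5)] by auto
    then show "apex_witness G n c d"
      unfolding apex_witness_def using lv by (intro exI[of _ j]) auto
  next
    assume "apex_witness G n c d"
    then obtain j w a b where j: "j < n" and lv: "level G c (Suc j) w" "level G d (Suc j) w"
      "level G c j a" "level G d (Suc j) a" "level G c (Suc j) b" "level G d j b"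
      and e: "(a, w) \<in> G" "(w, b) \<in> G" "(a, b) \<notin> G"
      unfolding apex_witness_def by blast
    have "f w = Suc (Suc j)" "h w = Suc (Suc j)" "f a = Suc j" "h a = Suc (Suc j)" "f b = Suc (Suc j)" "h b = Suc j"
      using f h lv j by simp_all
    moreover have "E a w" "E w b" "\<not> E a b" "w < n" "a < n" "b < n"
      using e unfolding G_iff by auto
    ultimately show "apex_cond n E c d"
      unfolding cond by (intro exI[of _ w] conjI exI[of _ a] exI[of _ b]) simp_all
  qed
qed

text \<open>With a bull both sides hold. The case split leaves a bull-free graph, as completeness
  requires; for soundness, an odd hole found after the deletion is one of the whole graph.\<close>

lemma bull_or_odd_hole_iff:
  assumes "simple_graph n E"
  shows "contains_bull n E \<or> contains_odd_hole n E \<longleftrightarrow>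
    bull_cond n E \<or> (\<exists>c<n. \<exists>d<n. E c d \<and> apex_cond n E c d)"
proof (cases "bull_cond n E")
  case True
  then show ?thesis using contains_bull_iff[OF assms] by blast
next
  case False
  note R = sym_edges[OF assms] irrefl_edges[OF assms]
  have "contains_odd_hole n E \<longleftrightarrow> (\<exists>c<n. \<exists>d<n. E c d \<and> apex_cond n E c d)"
  proof
    assume "contains_odd_hole n E"
    then obtain m g where m: "odd m" "5 \<le> m" "hole (edges n E) (int m) g" "m \<le> n"
      unfolding contains_odd_hole_iff by blast
    have "\<not> has_bull (edges n E)" using False bull_cond_iff[OF assms] by blast
    from apex_witness_if_odd_hole[OF R this m] obtain c d where
      "(c, d) \<in> edges n E" "apex_witness (bfs_graph n E c d) n c d" .
    then show "\<exists>c<n. \<exists>d<n. E c d \<and> apex_cond n E c d"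
      using apex_cond_iff[OF assms] unfolding edges_def by auto
  next
    assume "\<exists>c<n. \<exists>d<n. E c d \<and> apex_cond n E c d"
    then obtain c d where cd: "c < n" "d < n" "E c d" "apex_witness (bfs_graph n E c d) n c d"
      using apex_cond_iff[OF assms] by blast
    define G where "G = bfs_graph n E c d"
    have "\<not> E c c" "\<not> E d d" using assms cd simple_graphD(2) by blast+
    then have "(c, d) \<in> G" using cd unfolding G_def without_common_def edges_def by auto
    moreover have "sym G" "irrefl G"
      using R unfolding G_def without_common_def sym_def irrefl_def by auto
    ultimately obtain m g where m: "odd m" "5 \<le> m" "hole G (int m) g"
      using odd_hole_if_apex_witness cd(4) unfolding G_def by metis
    then have h: "hole (edges n E) (int m) g"
      unfolding G_def without_common_def using hole_Restr by blast
    have "m \<le> n"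
    proof -
      have "g (int u) < n" for u
      proof -
        have "(g (int u), g (int u + 1)) \<in> edges n E" using hole_adj_iff[OF h] by simp
        then show ?thesis unfolding edges_def by simp
      qed
      then have "(\<lambda>u. g (int u)) ` {..<m} \<subseteq> {..<n}" by auto
      moreover have "inj_on (\<lambda>u. g (int u)) {..<m}"
        using nat_hole_of_hole[OF h] unfolding nat_hole_def by blast
      ultimately show ?thesis using card_inj_on_le[of "\<lambda>u. g (int u)" "{..<m}" "{..<n}"] by simp
    qed
    then show "contains_odd_hole n E"
      unfolding contains_odd_hole_iff using m(1,2) h by blast
  qed
  then show ?thesis using False contains_bull_iff[OF assms] by blast
qed

text \<open>All registers but 0 start at zero, so only the constant one has to be set. The last
  instruction copies the flag to the output register 0, register 2 being zero; running past the end
  halts.\<close>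

definition program :: "instr list" where
  "program = [Const 1 1] @ code 1 main_com @ [Sub 0 3 2]"

lemma program_typed: "\<forall>x\<in>set program. typed exponent 8 x"
  unfolding program_def using typed_code[OF typed_main_com] by (auto simp: exponent_def)

lemma within_init: "within n exponent 8 (init_state n E)"
proof -
  have "n \<le> (n + 2) ^ exponent 0" by (simp add: exponent_def)
  then show ?thesis unfolding within_def init_state_def by auto
qed

lemma values_bounded_program: "values_bounded ((n + 2) ^ 14) (run program t (init_state n E))"
proof -
  have le: "(n + 2) ^ e \<le> (n + 2) ^ 14" if "e \<le> 14" for e
    using that by (intro power_increasing) auto
  have exp: "exponent r \<le> 14" for r unfolding exponent_def by auto
  have "within n exponent 8 (run program t (init_state n E))"
    by (rule within_run[OF program_typed within_init])
  then show ?thesis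
    unfolding within_def values_bounded_def using order_trans[OF _ le[OF exp]] order_trans[OF _ le[of 8]]
    by auto
qed

lemma sem_main_com:
  assumes "simple_graph n E" "fst s 0 = n" "fst s 1 = 1" "fst s 2 = 0" "fst s 3 = 0" "adj_matrix n E (snd s)"
  shows "fst (sem main_com s) 3 = (if contains_bull n E \<or> contains_odd_hole n E then 1 else 0)"
proof -
  obtain R M where s: "s = (R, M)" by fastforce
  define R1 where "R1 = R(18 := n * n, 19 := n * n + n)"
  have b1: "base n R1" and M: "adj_matrix n E M" and "R1 3 = 0"
    using assms unfolding s R1_def base_def by auto
  obtain R2 M2 where s2: "sem bull_com (R1, M) = (R2, M2)" by fastforce
  have t2: "adj_matrix n E M2" "R2 3 = (if bull_cond n E then 1 else 0)"
    using testsD[OF tests_bull_com b1 M _ s2] \<open>R1 3 = 0\<close> by simp_all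
  have b2: "base n R2"
    using base_unwritten[of n "(R1, M)" bull_com] b1 s2 tests_bull_com unfolding tests_def by simp
  obtain R3 M3 where s3: "sem odd_hole_com (R2, M2) = (R3, M3)" by fastforce
  have "R3 3 = (if \<exists>c<n. \<exists>d<n. E c d \<and> apex_cond n E c d then 1 else R2 3)"
    using testsD(2)[OF tests_odd_hole_com[OF assms(1)] b2 t2(1) _ s3] by simp
  moreover have "sem (Basic [Mul 18 0 0, Add 19 18 0]) s = (R1, M)"
    using assms(2) unfolding s R1_def by simp
  then have "sem main_com s = (R3, M3)"
    unfolding main_com_def using s2 s3 by (simp only: sem.simps(2))
  ultimately show ?thesis
    using t2(2) bull_or_odd_hole_iff[OF assms(1)] by auto
qed

theorem theorem1p3:
  shows "\<exists>P c k. decides_in_time P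
            (\<lambda>n E. contains_bull n E \<or> contains_odd_hole n E)
            (\<lambda>n. c * (n + 1) ^ 5) k"
proof -
  have "decides_in_time program (\<lambda>n E. contains_bull n E \<or> contains_odd_hole n E)
      (\<lambda>n. (weight main_com + 2) * (n + 1) ^ 5) 14"
    unfolding decides_in_time_def
  proof (intro allI impI)
    fix n E assume G: "simple_graph n E"
    define M :: "nat \<Rightarrow> nat" where
      "M = (\<lambda>a. if a < n * n \<and> E (a div n) (a mod n) then 1 else 0)"
    define R0 :: "nat \<Rightarrow> nat" where "R0 = (\<lambda>_. 0)(0 := n)"
    define R1 where "R1 = R0(1 := 1)"
    have M: "adj_matrix n E M"
      unfolding adj_matrix_def
    proof (intro allI impI)
      fix u v assume "u < n" "v < n"
      have "u * n + v < Suc u * n" using \<open>v < n\<close> by simp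
      also have "\<dots> \<le> n * n" using \<open>u < n\<close> by (intro mult_le_mono1) simp
      finally show "M (u * n + v) = (if E u v then 1 else 0)"
        using \<open>v < n\<close> unfolding M_def by simp
    qed
    obtain R2 M2 where s2: "sem main_com (R1, M) = (R2, M2)" by fastforce
    have R2: "R2 3 = (if contains_bull n E \<or> contains_odd_hole n E then 1 else 0)"
      using sem_main_com[OF G, of "(R1, M)"] M s2 unfolding R1_def R0_def by simp
    have "2 \<notin> writes main_com" using writes_main_com by blast
    then have "R2 2 = 0" using sem_unwritten[of 2 main_com "(R1, M)"] s2 unfolding R1_def R0_def by simp
    define s3 where "s3 = (R2(0 := R2 3), M2)"
    define e where "e = 1 + code_size main_com"
    have at: "0 < length program" "program ! 0 = Const 1 1" "code_at program 1 (code 1 main_com)"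
      "e < length program" "program ! e = Sub 0 3 2" "length program = Suc e"
    proof -
      have "code_at program 0 ([Const 1 1] @ code 1 main_com @ [Sub 0 3 2])"
        unfolding code_at_def program_def by (intro exI[of _ "[]"]) simp
      then show "0 < length program" "program ! 0 = Const 1 1" "code_at program 1 (code 1 main_com)"
        "e < length program" "program ! e = Sub 0 3 2"
        unfolding code_at_append by (auto simp: code_at_Cons e_def)
    qed (simp add: program_def e_def)
    have "reach program 1 0 (R0, M) 1 (R1, M)"
      using reach_step[OF at(1,2)] unfolding R1_def by simp
    moreover have "reach program (time main_com n) 1 (R1, M) e (R2, M2)"
      using reach_code[OF wf_main_com at(3) writes_main_com, of "(R1, M)" n] s2
      unfolding R1_def R0_def e_def by simp
    moreover have "reach program 1 e (R2, M2) (length program) s3"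
      using reach_step[OF at(4,5)] \<open>R2 2 = 0\<close> unfolding s3_def at(6) by simp
    ultimately have "reach program (time main_com n + 2) 0 (R0, M) (length program) s3"
      using reach_trans[OF reach_trans[OF _ _ order_refl]] by fastforce
    then obtain t where t: "t \<le> time main_com n + 2"
      "run program t (St 0 R0 M) = St (length program) (R2(0 := R2 3)) M2"
      unfolding reach_def s3_def by auto
    have init: "init_state n E = St 0 R0 M" unfolding init_state_def R0_def M_def ..
    \<comment> \<open>The summand 2 in the constant pays for the two instructions around
      \<open>main_com\<close>.\<close>
    have "2 \<le> 2 * (n + 1) ^ 5" by simp
    then have "t \<le> (weight main_com + 2) * (n + 1) ^ 5"
      using t(1) time_le[of main_com n] unfolding depth_main_com distrib_right by linarith
    moreover have "halted program (run program t (init_state n E))"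
      unfolding init t(2) halted_def by simp
    moreover have "regs (run program t (init_state n E)) 0 =
        (if contains_bull n E \<or> contains_odd_hole n E then 1 else 0)"
      unfolding init t(2) using R2 by simp
    ultimately show "\<exists>t\<le>(weight main_com + 2) * (n + 1) ^ 5.
        halted program (run program t (init_state n E)) \<and>
        regs (run program t (init_state n E)) 0 =
          (if contains_bull n E \<or> contains_odd_hole n E then 1 else 0) \<and>
        (\<forall>t'\<le>t. values_bounded ((n + 2) ^ 14) (run program t' (init_state n E)))"
      using values_bounded_program by blast
  qed
  then show ?thesis by blast
qed

end
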